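(* Let $d$ be a constant nonnegative integer. The posimodular function maximization problem for posimodular functions $f:2^V\to\{0,1,\dots,d\}$ (given a value oracle for $f$, output a nonempty subset $X\subseteq V$ maximizing $f$ together with the optimal value), where $n=|V|$, has time complexity $\Theta(n^{d-1}T_f)$.
   Context: A set function $f:2^V\to\mathbb{R}$ is posimodular if $f(X)+f(Y)\ge f(X\setminus Y)+f(Y\setminus X)$ for all $X,Y\subseteq V$. $T_f$ denotes the time needed to evaluate $f(X)$ for a given $X\subseteq V$. Throughout, $f(\emptyset)=0$ is assumed.
   Formalization: Proved for d ≥ 2 only; the claim fails for d = 0 (f = 0, no oracle call is needed, so time is not Ω(T_f/n)) and for d = 1 (the functions f(X) = 1 iff X contains exactly one of u, v force Ω(log n) oracle calls, so time is not O(T_f)). *)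

theory Defs
  imports Complex_Main "HOL-Library.FuncSet" "HOL-Library.Landau_Symbols"
begin

definition posimodular :: "'a set \<Rightarrow> ('a set \<Rightarrow> real) \<Rightarrow> bool" where
  "posimodular V f \<longleftrightarrow> (\<forall>X\<subseteq>V. \<forall>Y\<subseteq>V. f X + f Y \<ge> f (X - Y) + f (Y - X))"

text \<open>
  The inputs of size \<open>n\<close>. The ground set is \<open>{..<n}\<close>, which is no restriction since an
  algorithm has to address the elements of \<open>V\<close> somehow. Set functions are taken extensional on
  the power set, so that there are only finitely many of them for each \<open>n\<close>.
\<close>

definition instances :: "nat \<Rightarrow> nat \<Rightarrow> (nat set \<Rightarrow> nat) set" where
  "instances d n =
    {f \<in> Pow {..<n} \<rightarrow>\<^sub>E {0..d}. f {} = 0 \<and> posimodular {..<n} (\<lambda>X. real (f X))}"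

definition is_maximizer :: "nat \<Rightarrow> (nat set \<Rightarrow> nat) \<Rightarrow> nat set \<Rightarrow> bool" where
  "is_maximizer n f X \<longleftrightarrow>
    X \<noteq> {} \<and> X \<subseteq> {..<n} \<and> (\<forall>Y. Y \<noteq> {} \<and> Y \<subseteq> {..<n} \<longrightarrow> f Y \<le> f X)"

text \<open>
  The model of computation is a deterministic random access machine with a value oracle,
  with structured control flow in place of jumps. Arithmetic is limited to addition and
  truncated subtraction, so the unit-cost measure is the usual realistic one.
\<close>

type_synonym memory = "nat \<Rightarrow> nat"

datatype program =
    Const nat nat             \<comment> \<open>\<open>R[i] := k\<close>\<close>
  | Add nat nat nat           \<comment> \<open>\<open>R[i] := R[j] + R[k]\<close>\<close>
  | Sub nat nat nat           \<comment> \<open>\<open>R[i] := R[j] - R[k]\<close>\<close>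
  | Load nat nat              \<comment> \<open>\<open>R[i] := R[R[j]]\<close>\<close>
  | Store nat nat             \<comment> \<open>\<open>R[R[i]] := R[j]\<close>\<close>
  | Query nat nat             \<comment> \<open>\<open>R[i] := f X\<close>, with \<open>X\<close> stored from address \<open>R[j]\<close> on\<close>
  | Seq program program
  | If nat program program    \<comment> \<open>branches on \<open>R[i] \<noteq> 0\<close>\<close>
  | While nat program         \<comment> \<open>loops while \<open>R[i] \<noteq> 0\<close>\<close>

text \<open>
  Subsets of \<open>{..<n}\<close> are stored as characteristic vectors in \<open>n\<close> consecutive cells.
\<close>

definition set_at :: "nat \<Rightarrow> memory \<Rightarrow> nat \<Rightarrow> nat set" where
  "set_at n s a = {v. v < n \<and> s (a + v) \<noteq> 0}"

text \<open>
  \<open>run f n T P s t s'\<close>: on oracle \<open>f\<close> over \<open>{..<n}\<close>, program \<open>P\<close> started in \<open>s\<close> halts in \<open>s'\<close>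
  after time \<open>t\<close>, where an oracle call takes time \<open>T\<close> (the quantity \<open>T\<^sub>f\<close>) and every other
  instruction or test takes time 1.
\<close>

inductive run ::
  "(nat set \<Rightarrow> nat) \<Rightarrow> nat \<Rightarrow> nat \<Rightarrow> program \<Rightarrow> memory \<Rightarrow> nat \<Rightarrow> memory \<Rightarrow> bool"
  for f :: "nat set \<Rightarrow> nat" and n T :: nat
where
  run_Const: "run f n T (Const i k) s 1 (s(i := k))"
| run_Add: "run f n T (Add i j k) s 1 (s(i := s j + s k))"
| run_Sub: "run f n T (Sub i j k) s 1 (s(i := s j - s k))"
| run_Load: "run f n T (Load i j) s 1 (s(i := s (s j)))"
| run_Store: "run f n T (Store i j) s 1 (s(s i := s j))"
| run_Query: "run f n T (Query i j) s T (s(i := f (set_at n s (s j))))"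
| run_Seq: "run f n T P s t s' \<Longrightarrow> run f n T Q s' u s'' \<Longrightarrow> run f n T (Seq P Q) s (t + u) s''"
| run_If_True: "s i \<noteq> 0 \<Longrightarrow> run f n T P s t s' \<Longrightarrow> run f n T (If i P Q) s (1 + t) s'"
| run_If_False: "s i = 0 \<Longrightarrow> run f n T Q s t s' \<Longrightarrow> run f n T (If i P Q) s (1 + t) s'"
| run_While_False: "s i = 0 \<Longrightarrow> run f n T (While i P) s 1 s"
| run_While_True: "s i \<noteq> 0 \<Longrightarrow> run f n T P s t s' \<Longrightarrow> run f n T (While i P) s' u s'' \<Longrightarrow>
    run f n T (While i P) s (1 + t + u) s''"

text \<open>
  Initially cell 0 holds \<open>n\<close> and all other cells are 0. On termination cell 0 must hold the
  optimal value and cell 1 the address of a maximizer.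
\<close>

definition init_memory :: "nat \<Rightarrow> memory" where
  "init_memory n = (\<lambda>_. 0)(0 := n)"

definition solves_maximization :: "nat \<Rightarrow> program \<Rightarrow> bool" where
  "solves_maximization d P \<longleftrightarrow>
    (\<forall>n\<ge>1. \<forall>T\<ge>1. \<forall>f\<in>instances d n. \<exists>t s. run f n T P (init_memory n) t s \<and>
      is_maximizer n f (set_at n s (s 1)) \<and> s 0 = f (set_at n s (s 1)))"

text \<open>
  For programs that halt on all inputs, such as those with \<open>solves_maximization d P\<close>, the set
  below is finite and nonempty, since runs are deterministic.
\<close>

definition worst_case_time :: "nat \<Rightarrow> program \<Rightarrow> nat \<Rightarrow> nat \<Rightarrow> nat" where
  "worst_case_time d P n T = Max {t. \<exists>f\<in>instances d n. \<exists>s. run f n T P (init_memory n) t s}"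

text \<open>
  Asymptotics in \<open>(n, T)\<close>: eventually in \<open>n\<close>, uniformly in all \<open>T \<ge> 1\<close>.
\<close>

definition size_cost_filter :: "(nat \<times> nat) filter" where
  "size_cost_filter = at_top \<times>\<^sub>F principal {1..}"

text \<open>
  The problem (for fixed \<open>d\<close>) has time complexity \<open>\<Theta>(g n T)\<close>: some algorithm runs in time
  \<open>O(g n T)\<close>, and every algorithm needs time \<open>\<Omega>(g n T)\<close>.
\<close>

definition maximization_has_time_complexity :: "nat \<Rightarrow> (nat \<Rightarrow> nat \<Rightarrow> real) \<Rightarrow> bool" where
  "maximization_has_time_complexity d g \<longleftrightarrow>
    (\<exists>P. solves_maximization d P \<and>
      (\<lambda>(n, T). real (worst_case_time d P n T)) \<in> O[size_cost_filter](\<lambda>(n, T). g n T)) \<and>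
    (\<forall>P. solves_maximization d P \<longrightarrow>
      (\<lambda>(n, T). real (worst_case_time d P n T)) \<in> \<Omega>[size_cost_filter](\<lambda>(n, T). g n T))"

end

theory Submission
  imports Defs
begin

text \<open>
  Lower bound: the sets \<open>X\<close> of size \<open>n + 1 - d\<close> have value \<open>d - 1\<close> under
  \<open>min (card X) (min (d - 1) (n + 1 - card X))\<close>, and raising the value of a single one of them to
  \<open>d\<close> preserves posimodularity, so all of them have to be queried.

  Upper bound: off a maximizer \<open>X\<close> the function is monotone, and off an inclusion-maximal one it is
  strictly monotone, so fewer than \<open>d\<close> elements are missing from \<open>X\<close> unless the maximum is \<open>d\<close>.
  If \<open>d\<close> elements are missing from every inclusion-maximal maximizer, then there is a maximizer
  \<open>B \<union> {p, q}\<close> of size \<open>d\<close>, and all but at most \<open>d\<close> of the elements \<open>c\<close> with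
  \<open>f (B \<union> {c}) \<ge> d - 1\<close> extend to a maximizer \<open>B \<union> {c, q'}\<close>. It therefore suffices to try
  \<open>d + 1\<close> such elements \<open>c\<close> for every set \<open>B\<close> of size \<open>d - 2\<close>, besides all sets missing fewer
  than \<open>d\<close> elements. Storing an improved set costs \<open>O(n)\<close>, but happens at most \<open>d\<close> times.
\<close>

section \<open>Maximizers of posimodular functions\<close>

locale posimodular_fun =
  fixes V :: "'a set" and f :: "'a set \<Rightarrow> nat" and d :: nat
  assumes finite_V: "finite V"
    and f_le: "X \<subseteq> V \<Longrightarrow> f X \<le> d"
    and posi: "\<lbrakk>X \<subseteq> V; Y \<subseteq> V\<rbrakk> \<Longrightarrow> f (X - Y) + f (Y - X) \<le> f X + f Y"
begin

text \<open>Unlike in \<open>is_maximizer\<close>, the empty set counts. Only values are compared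
  with these sets later, so this is harmless.\<close>

definition maximizers :: "'a set set" where
  "maximizers = {X. X \<subseteq> V \<and> (\<forall>Y\<subseteq>V. f Y \<le> f X)}"

lemma maximizers_subset: "X \<in> maximizers \<Longrightarrow> X \<subseteq> V"
  and maximizers_le: "X \<in> maximizers \<Longrightarrow> Y \<subseteq> V \<Longrightarrow> f Y \<le> f X"
  by (auto simp: maximizers_def)

lemma maximizersI: "X \<in> maximizers \<Longrightarrow> Y \<subseteq> V \<Longrightarrow> f X \<le> f Y \<Longrightarrow> Y \<in> maximizers"
  unfolding maximizers_def by (blast intro: order_trans)

lemma maximizers_eq: "X \<in> maximizers \<Longrightarrow> Y \<in> maximizers \<Longrightarrow> f X = f Y"
  by (simp add: le_antisym maximizers_le maximizers_subset)

lemma ex_maximizer: "\<exists>X. X \<in> maximizers"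
proof -
  have "finite (f ` Pow V)" "f ` Pow V \<noteq> {}"
    using finite_V by auto
  then have "Max (f ` Pow V) \<in> f ` Pow V" and "\<And>Y. Y \<subseteq> V \<Longrightarrow> f Y \<le> Max (f ` Pow V)"
    by (auto intro: Max_in Max_ge)
  then obtain X where "X \<subseteq> V" "\<And>Y. Y \<subseteq> V \<Longrightarrow> f Y \<le> f X"
    by (metis PowD imageE)
  then show ?thesis
    unfolding maximizers_def by blast
qed

text \<open>The form in which posimodularity is used: the two differences cancel the common part
  \<open>C\<close> and leave \<open>A\<close> and \<open>B\<close>.\<close>

lemma posi_disjoint:
  assumes "A \<subseteq> V" "B \<subseteq> V" "C \<subseteq> V" "A \<inter> B = {}" "A \<inter> C = {}" "B \<inter> C = {}"
  shows "f A + f B \<le> f (A \<union> C) + f (B \<union> C)"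
proof -
  have "A \<union> C - (B \<union> C) = A" "B \<union> C - (A \<union> C) = B"
    using assms by auto
  then show ?thesis
    using posi[of "A \<union> C" "B \<union> C"] assms by simp
qed

text \<open>Take \<open>C = E - D\<close> in \<open>posi_disjoint\<close>: adding \<open>C\<close>
  to the maximizer \<open>X\<close> cannot raise its value, so adding \<open>C\<close> to
  \<open>D\<close> cannot lower that of \<open>D\<close>.\<close>

lemma mono_off_maximizer:
  assumes "X \<in> maximizers" "D \<subseteq> E" "E \<subseteq> V - X"
  shows "f D \<le> f E"
proof -
  have DE: "D \<union> (E - D) = E"
    using assms by auto
  have "f X + f D \<le> f (X \<union> (E - D)) + f E"
    using posi_disjoint[of X D "E - D"] assms maximizers_subset[of X] unfolding DE by blast
  moreover have "f (X \<union> (E - D)) \<le> f X"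
    using assms maximizers_subset[of X] by (intro maximizers_le) auto
  ultimately show ?thesis by simp
qed

text \<open>The same exchange with \<open>C = {e}\<close>; now the value of \<open>X\<close> drops
  strictly, so that of \<open>D\<close> must rise.\<close>

lemma strict_off_maximizer:
  assumes X: "X \<in> maximizers" and e: "e \<in> V - X" "insert e X \<notin> maximizers"
    and D: "D \<subseteq> V - X" "e \<notin> D"
  shows "f D < f (insert e D)"
proof -
  have "f X + f D \<le> f (X \<union> {e}) + f (D \<union> {e})"
    using assms maximizers_subset[OF X] by (intro posi_disjoint) auto
  moreover have "f (insert e X) < f X"
    using maximizersI[OF X, of "insert e X"] e maximizers_subset[OF X] by force
  ultimately show ?thesis by simp
qed

lemma card_le_off_maximizer:
  assumes X: "X \<in> maximizers" and max: "\<And>e. e \<in> V - X \<Longrightarrow> insert e X \<notin> maximizers"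
    and D: "D \<subseteq> V - X"
  shows "card D \<le> f D"
proof -
  have "finite D" using D finite_V finite_subset by fast
  then show ?thesis using D
  proof (induction D rule: finite_induct)
    case (insert e D)
    then have "f D < f (insert e D)"
      using strict_off_maximizer[OF X, of e D] max[of e] by auto
    with insert show ?case by simp
  qed simp
qed

text \<open>Enlarge \<open>X\<close> to an inclusion-maximal maximizer. On its complement
  \<open>f\<close> dominates cardinality, and the complement has at least \<open>d\<close> elements,
  so the bound \<open>d\<close> on \<open>f\<close> forces equality.\<close>

lemma small_maximizer_off_maximizer:
  assumes cosize: "\<And>X. X \<in> maximizers \<Longrightarrow> d \<le> card (V - X)" and X: "X \<in> maximizers"
  shows "\<exists>S\<in>maximizers. S \<subseteq> V - X \<and> card S = d \<and> f S = d"
proof -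
  have "finite maximizers"
    by (rule finite_subset[of _ "Pow V"]) (auto simp: maximizers_def finite_V)
  from finite_has_maximal2[OF this X] obtain X' where
    X': "X' \<in> maximizers" "X \<subseteq> X'" and max: "\<forall>Y\<in>maximizers. X' \<subseteq> Y \<longrightarrow> X' = Y"
    by blast
  have "insert e X' \<notin> maximizers" if "e \<in> V - X'" for e
    using max that by blast
  from card_le_off_maximizer[OF X'(1) this] have "card (V - X') \<le> f (V - X')"
    by blast
  with cosize[OF X'(1)] f_le[of "V - X'"] have eq: "f (V - X') = d" "card (V - X') = d"
    by auto
  then have "V - X' \<in> maximizers"
    using f_le unfolding maximizers_def by auto
  with eq X'(2) show ?thesis by blast
qed

text \<open>
  If no set in \<open>maximizers\<close> has fewer than \<open>d\<close> elements outside it, then \<open>maximizers\<close> is closed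
  under complement and \<open>f\<close> is a matroid rank function on each of its members. An independent
  set \<open>B\<close> of size \<open>d - 2\<close> contained in a basis \<open>B \<union> {p, q}\<close> can be greedily completed to a
  basis through every element \<open>c\<close> that increases \<open>f\<close>, except if \<open>c\<close> is a coloop of the
  complement of \<open>B \<union> {p, q}\<close>; there are at most \<open>d\<close> of these.
\<close>

lemma maximizer_search_space:
  assumes d: "d \<ge> 2"
  obtains (cosmall) W where "W \<subseteq> V" "card W \<le> d - 1" "V - W \<in> maximizers"
  | (greedy) B K p where "B \<subseteq> V" "card B = d - 2" "finite K" "card K \<le> d" "p \<in> V - K" "f (insert p B) \<ge> d - 1"
      "\<And>c. c \<in> V - K \<Longrightarrow> f (insert c B) \<ge> d - 1 \<Longrightarrow> \<exists>q\<in>V. f (insert q (insert c B)) = d"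
proof (cases "\<exists>X\<in>maximizers. card (V - X) \<le> d - 1")
  case True
  then obtain X where "X \<in> maximizers" "card (V - X) \<le> d - 1" by blast
  then show thesis
    using cosmall[of "V - X"] maximizers_subset[of X] by (simp add: double_diff)
next
  case False
  with d have cosize: "d \<le> card (V - X)" if "X \<in> maximizers" for X
    using that by force
  have small: "\<exists>S\<in>maximizers. S \<subseteq> V - X \<and> card S = d \<and> f S = d" if "X \<in> maximizers" for X
    using small_maximizer_off_maximizer cosize that by blast
  \<comment> \<open>\<open>V - X\<close> contains a maximizer \<open>S\<close>, and \<open>f\<close>
    is monotone inside \<open>V - X\<close>.\<close>
  have compl: "V - X \<in> maximizers" if X: "X \<in> maximizers" for X
  proof -
    from small[OF X] obtain S where S: "S \<in> maximizers" "S \<subseteq> V - X" by blast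
    then show ?thesis
      using mono_off_maximizer[OF X S(2)] by (intro maximizersI[OF S(1)]) auto
  qed
  have small_sub: "\<exists>S\<in>maximizers. S \<subseteq> X \<and> card S = d \<and> f S = d" if X: "X \<in> maximizers" for X
    using small[OF compl[OF X]] maximizers_subset[OF X] by (simp add: double_diff)
  have card_ge: "d \<le> card X" if X: "X \<in> maximizers" for X
    using cosize[OF compl[OF X]] maximizers_subset[OF X] by (simp add: double_diff)
  have compl_iff: "V - X \<in> maximizers \<longleftrightarrow> X \<in> maximizers" if "X \<subseteq> V" for X
    using compl[of X] compl[of "V - X"] that by (auto simp: double_diff)
  \<comment> \<open>Contrapositive of strict growth off \<open>V - Z\<close>: an element of
    \<open>Z\<close> that adds nothing to some \<open>D\<close> can be moved to the
    complement.\<close>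
  have delete: "Z - {e} \<in> maximizers"
    if Z: "Z \<in> maximizers" and e: "e \<in> Z" "e \<notin> D" and D: "D \<subseteq> Z" and le: "f (insert e D) \<le> f D" for Z D e
  proof -
    have ZV: "Z \<subseteq> V" by (rule maximizers_subset[OF Z])
    have "insert e (V - Z) \<in> maximizers"
      using strict_off_maximizer[OF compl[OF Z], of e D] e D le ZV by fastforce
    moreover have "V - insert e (V - Z) = Z - {e}"
      using ZV by auto
    ultimately show ?thesis
      using compl by metis
  qed
  obtain Z where Z: "Z \<in> maximizers" "card Z = d" "f Z = d"
    using ex_maximizer small_sub by blast
  have ZV: "Z \<subseteq> V" by (rule maximizers_subset[OF Z(1)])
  obtain p where p: "p \<in> Z" using Z(2) d by fastforce
  have "card (Z - {p}) = d - 1" using p Z(2) by simp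
  then obtain q where q: "q \<in> Z" "q \<noteq> p" using d
    by (metis Diff_iff One_nat_def Suc_1 card_eq_0_iff diff_is_0_eq equals0I insertI1 not_less_eq_eq)
  define B where "B = Z - {p, q}"
  have Zeq: "Z = insert p (insert q B)" using p q unfolding B_def by blast
  have pq: "p \<notin> B" "q \<notin> B" by (auto simp: B_def)
  have finB: "finite B" using finite_subset[OF ZV finite_V] by (simp add: B_def)
  have cardB: "card B = d - 2" using Z(2) q pq finB unfolding Zeq by simp
  define X where "X = V - Z"
  have X: "X \<in> maximizers" unfolding X_def by (rule compl[OF Z(1)])
  have VX: "V - X = Z" using ZV by (auto simp: X_def)
  have nX: "insert e X \<notin> maximizers" if "e \<in> Z" for e
  proof
    assume "insert e X \<in> maximizers"
    moreover have "V - insert e X = Z - {e}" using ZV by (auto simp: X_def)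
    ultimately have "Z - {e} \<in> maximizers" using compl by metis
    from card_ge[OF this] show False using that Z(2) d finite_subset[OF ZV finite_V] by simp
  qed
  have strict: "f D < f (insert e D)" if "e \<in> Z" "D \<subseteq> Z" "e \<notin> D" for e D
    using strict_off_maximizer[OF X, of e D] nX that by (auto simp: VX)
  have pB: "d - 1 \<le> f (insert p B)"
  proof -
    have "card (insert p B) \<le> f (insert p B)"
      by (rule card_le_off_maximizer[OF X]) (use nX Zeq VX in auto)
    then show ?thesis using pq cardB finB d by simp
  qed
  \<comment> \<open>From \<open>B\<close> to \<open>Z\<close>, of value \<open>d\<close>, there are
    two strict increases.\<close>
  have fB: "f B \<le> d - 2"
  proof -
    have "f B < f (insert p B)" "f (insert p B) < f (insert q (insert p B))"
      using strict[of p B] strict[of q "insert p B"] pq q p by (auto simp: B_def)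
    then show ?thesis using Z(3) Zeq insert_commute[of p q B] by simp
  qed
  \<comment> \<open>The coloops of \<open>X\<close>. Each lies in the basis \<open>S\<close>, since
    otherwise monotonicity off \<open>Z\<close> would carry the value of \<open>S\<close> over to
    \<open>X - {c}\<close>.\<close>
  define K where "K = {c \<in> X. X - {c} \<notin> maximizers}"
  obtain S where S: "S \<in> maximizers" "S \<subseteq> X" "card S = d" "f S = d"
    using small_sub[OF X] by blast
  have "K \<subseteq> S"
  proof
    fix c assume c: "c \<in> K"
    show "c \<in> S"
    proof (rule ccontr)
      assume "c \<notin> S"
      with S(2) have "f S \<le> f (X - {c})"
        by (intro mono_off_maximizer[OF Z(1)]) (auto simp: X_def)
      then have "X - {c} \<in> maximizers"
        by (intro maximizersI[OF S(1)]) (auto simp: X_def)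
      with c show False by (simp add: K_def)
    qed
  qed
  moreover have "finite S" using S(3) d by (intro card_ge_0_finite) simp
  ultimately have K: "finite K" "card K \<le> d" using S(3) card_mono[of S K] finite_subset[of K S] by auto
  show thesis
  proof (rule greedy)
    show "B \<subseteq> V" using ZV Zeq by auto
    show "p \<in> V - K" using p ZV by (auto simp: K_def X_def)
    fix c assume c: "c \<in> V - K" and fc: "f (insert c B) \<ge> d - 1"
    consider "c \<in> B" | "c = p" | "c = q" | "c \<in> X"
      using c Zeq by (auto simp: X_def)
    then show "\<exists>q\<in>V. f (insert q (insert c B)) = d"
    proof cases
      case 1
      with fB fc d show ?thesis by (simp add: insert_absorb)
    next
      case 2
      then show ?thesis using q ZV Z(3) Zeq insert_commute[of p q B] by auto
    next
      case 3
      then show ?thesis using p ZV Z(3) Zeq by auto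
    next
      case 4
      with c have "X - {c} \<in> maximizers" by (simp add: K_def)
      moreover have "V - (X - {c}) = insert c Z" using 4 ZV by (auto simp: X_def)
      ultimately have cZ: "insert c Z \<in> maximizers" using compl by metis
      have cn: "c \<notin> Z" using 4 by (simp add: X_def)
      show ?thesis
      \<comment> \<open>Either \<open>p\<close> adds nothing, and deleting it from
        \<open>insert c Z\<close> leaves a maximizer containing \<open>q\<close>; or it lifts the
        value above \<open>d - 1\<close>, hence to \<open>d\<close>.\<close>
      proof (cases "f (insert p (insert c B)) \<le> f (insert c B)")
        case True
        have "insert c Z - {p} \<in> maximizers"
          by (rule delete[OF cZ _ _ _ True]) (use cn p pq Zeq in auto)
        moreover have "insert c Z - {p} = insert q (insert c B)"
          using cn p q pq Zeq by auto
        ultimately show ?thesis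
          using maximizers_eq[OF _ Z(1)] Z(3) q ZV by auto
      next
        case False
        then have "f (insert p (insert c B)) = d"
          using fc f_le[of "insert p (insert c B)"] c ZV Zeq by auto
        then show ?thesis using p ZV by auto
      qed
    qed
  qed (use cardB K pB in auto)
qed

end

section \<open>The lower bound\<close>

inductive_cases run_elims:
  "run f n T (Const i k) s t s'"
  "run f n T (Add i j k) s t s'"
  "run f n T (Sub i j k) s t s'"
  "run f n T (Load i j) s t s'"
  "run f n T (Store i j) s t s'"
  "run f n T (Query i j) s t s'"
  "run f n T (Seq P Q) s t s'"
  "run f n T (If i P Q) s t s'"
  "run f n T (While i P) s t s'"

lemma run_deterministic:
  "run f n T P s t s' \<Longrightarrow> run f n T P s u s'' \<Longrightarrow> t = u \<and> s' = s''"
proof (induction arbitrary: u s'' rule: run.induct)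
  case (run_Seq P s t s' Q v s3)
  from run_Seq.prems obtain t1 s1 t2 where
    "run f n T P s t1 s1" "run f n T Q s1 t2 s''" "u = t1 + t2"
    by (rule run_elims)
  with run_Seq.IH(1)[of t1 s1] run_Seq.IH(2)[of t2 s''] show ?case by simp
next
  case (run_While_True s i P t s' v s3)
  obtain t1 s1 t2 where
    "run f n T P s t1 s1" "run f n T (While i P) s1 t2 s''" "u = 1 + t1 + t2"
    by (rule run_elims(9)[OF run_While_True.prems]) (use run_While_True.hyps(1) in auto)
  with run_While_True.IH(1)[of t1 s1] run_While_True.IH(2)[of t2 s''] show ?case by simp
next
  case (run_If_True s i P t s' Q)
  obtain t1 where
    "run f n T P s t1 s''" "u = 1 + t1"
    by (rule run_elims(8)[OF run_If_True.prems]) (use run_If_True.hyps(1) in auto)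
  with run_If_True.IH[of t1 s''] show ?case by simp
next
  case (run_If_False s i Q t s' P)
  obtain t1 where
    "run f n T Q s t1 s''" "u = 1 + t1"
    by (rule run_elims(8)[OF run_If_False.prems]) (use run_If_False.hyps(1) in auto)
  with run_If_False.IH[of t1 s''] show ?case by simp
next
  case (run_While_False s i P)
  show ?case
    by (rule run_elims(9)[OF run_While_False.prems]) (use run_While_False.hyps(1) in auto)
qed (erule run_elims; simp)+

lemma finite_instances: "finite (instances d n)"
  by (rule finite_subset[of _ "Pow {..<n} \<rightarrow>\<^sub>E {0..d}"])
    (auto simp: instances_def intro!: finite_PiE)

text \<open>Needed because \<open>worst_case_time\<close> is a \<open>Max\<close>. By determinism
  each of the finitely many instances contributes at most one time, named by
  \<open>THE\<close>.\<close>

lemma finite_running_times: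
  "finite {t. \<exists>f\<in>instances d n. \<exists>s. run f n T P s0 t s}"
proof (rule finite_subset)
  show "{t. \<exists>f\<in>instances d n. \<exists>s. run f n T P s0 t s}
    \<subseteq> (\<lambda>f. THE t. \<exists>s. run f n T P s0 t s) ` instances d n"
  proof safe
    fix t f s assume f: "f \<in> instances d n" and r: "run f n T P s0 t s"
    have "(THE t. \<exists>s. run f n T P s0 t s) = t"
      by (rule the_equality) (use r run_deterministic in blast)+
    with f show "t \<in> (\<lambda>f. THE t. \<exists>s. run f n T P s0 t s) ` instances d n" by force
  qed
qed (simp add: finite_instances)

lemma worst_case_time_ge:
  assumes "f \<in> instances d n" "run f n T P (init_memory n) t s"
  shows "t \<le> worst_case_time d P n T"
  unfolding worst_case_time_def
  by (rule Max_ge[OF finite_running_times]) (use assms in blast)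

lemma instances_nonempty: "instances d n \<noteq> {}"
proof -
  have "restrict (\<lambda>_. 0) (Pow {..<n}) \<in> instances d n"
    by (auto simp: instances_def posimodular_def intro!: order_trans[OF Diff_subset])
  then show ?thesis by blast
qed

lemma worst_case_time_le:
  assumes "\<And>f. f \<in> instances d n \<Longrightarrow> \<exists>t s. run f n T P (init_memory n) t s \<and> t \<le> c"
  shows "worst_case_time d P n T \<le> c"
proof -
  have "{t. \<exists>f\<in>instances d n. \<exists>s. run f n T P (init_memory n) t s} \<noteq> {}"
    using instances_nonempty assms by blast
  moreover have "t \<le> c" if "f \<in> instances d n" "run f n T P (init_memory n) t s" for f t s
    using assms[OF that(1)] that(2) run_deterministic by blast
  ultimately show ?thesis
    unfolding worst_case_time_def by (subst Max_le_iff[OF finite_running_times]) blast+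
qed

text \<open>Collect the queried sets in \<open>Q\<close>: each of them costs at least
  \<open>T\<close>, and the run cannot distinguish oracles that agree on them.\<close>

lemma run_queries:
  "run f n T P s t s' \<Longrightarrow>
    \<exists>Q. finite Q \<and> card Q * T \<le> t \<and> (\<forall>g. (\<forall>X\<in>Q. X \<subseteq> {..<n} \<longrightarrow> g X = f X) \<longrightarrow> run g n T P s t s')"
proof (induction rule: run.induct)
  case (run_Query i j s)
  have "run g n T (Query i j) s T (s(i := f (set_at n s (s j))))"
    if "g (set_at n s (s j)) = f (set_at n s (s j))" for g
    using run.run_Query[of g n T i j s] unfolding that .
  moreover have "set_at n s (s j) \<subseteq> {..<n}" by (auto simp: set_at_def)
  ultimately show ?case by (intro exI[of _ "{set_at n s (s j)}"]) (auto simp del: fun_upd_apply)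
next
  case (run_Seq P s t s' Q u s'')
  then obtain A B where
    A: "finite A" "card A * T \<le> t" "\<And>g. (\<forall>X\<in>A. X \<subseteq> {..<n} \<longrightarrow> g X = f X) \<Longrightarrow> run g n T P s t s'" and
    B: "finite B" "card B * T \<le> u" "\<And>g. (\<forall>X\<in>B. X \<subseteq> {..<n} \<longrightarrow> g X = f X) \<Longrightarrow> run g n T Q s' u s''"
    by blast
  have "card (A \<union> B) * T \<le> (card A + card B) * T" by (intro mult_right_mono card_Un_le) simp
  also have "\<dots> \<le> t + u" using A(2) B(2) by (simp add: algebra_simps)
  finally show ?case using A B
    by (intro exI[of _ "A \<union> B"]) (auto intro!: run.run_Seq)
next
  case (run_While_True s i P t s' u s'')
  then obtain A B where
    A: "finite A" "card A * T \<le> t" "\<And>g. (\<forall>X\<in>A. X \<subseteq> {..<n} \<longrightarrow> g X = f X) \<Longrightarrow> run g n T P s t s'" and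
    B: "finite B" "card B * T \<le> u" "\<And>g. (\<forall>X\<in>B. X \<subseteq> {..<n} \<longrightarrow> g X = f X) \<Longrightarrow> run g n T (While i P) s' u s''"
    by blast
  have "card (A \<union> B) * T \<le> (card A + card B) * T" by (intro mult_right_mono card_Un_le) simp
  also have "\<dots> \<le> 1 + t + u" using A(2) B(2) by (simp add: algebra_simps)
  finally show ?case using A B run_While_True.hyps(1)
    by (intro exI[of _ "A \<union> B"] conjI allI impI run.run_While_True) auto
next
  case (run_If_True s i P t s' Q)
  then obtain A where
    "finite A" "card A * T \<le> t" "\<And>g. (\<forall>X\<in>A. X \<subseteq> {..<n} \<longrightarrow> g X = f X) \<Longrightarrow> run g n T P s t s'" by blast
  with run_If_True.hyps show ?case by (intro exI[of _ A] conjI allI impI run.run_If_True) auto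
next
  case (run_If_False s i Q t s' P)
  then obtain A where
    "finite A" "card A * T \<le> t" "\<And>g. (\<forall>X\<in>A. X \<subseteq> {..<n} \<longrightarrow> g X = f X) \<Longrightarrow> run g n T Q s t s'" by blast
  with run_If_False.hyps show ?case by (intro exI[of _ A] conjI allI impI run.run_If_False) auto
qed (rule exI[of _ "{}"]; simp add: run.intros del: fun_upd_apply One_nat_def)+

section \<open>The adversary functions\<close>

text \<open>\<open>H\<close> is always empty or a singleton, so one definition covers the base
  function and its perturbations.\<close>

definition adversary :: "nat \<Rightarrow> nat \<Rightarrow> nat set set \<Rightarrow> nat set \<Rightarrow> nat" where
  "adversary d n H = (\<lambda>X\<in>Pow {..<n}.
     min (card X) (min (d - 1) (n + 1 - card X)) + (if X \<in> H then 1 else 0))"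

text \<open>Only cardinalities matter. If \<open>A = X - Y\<close> is the raised set and
  \<open>c > 0\<close> elements are shared, then \<open>b + c \<le> d - 1\<close>, and the right
  side is at least \<open>(d - c) + (b + c)\<close>, which is exactly the left side
  \<open>d + b\<close>.\<close>

lemma posimodular_adversary_aux:
  assumes d: "d \<ge> 2" and n: "n \<ge> 2 * d"
    and H: "\<And>X. X \<in> H \<Longrightarrow> card X = n + 1 - d \<and> X \<subseteq> {..<n}" and H1: "\<And>X Y. X \<in> H \<Longrightarrow> Y \<in> H \<Longrightarrow> X = Y"
    and X: "X \<subseteq> {..<n}" and Y: "Y \<subseteq> {..<n}"
  shows "adversary d n H (X - Y) + adversary d n H (Y - X) \<le> adversary d n H X + adversary d n H Y"
proof -
  define A B C where "A = X - Y" and "B = Y - X" and "C = X \<inter> Y"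
  have fin: "finite A" "finite B" "finite C" using finite_subset[OF X] finite_subset[OF Y] by (auto simp: A_def B_def C_def)
  have XA: "X = A \<union> C" and YB: "Y = B \<union> C" by (auto simp: A_def B_def C_def)
  have dis: "A \<inter> B = {}" "A \<inter> C = {}" "B \<inter> C = {}" by (auto simp: A_def B_def C_def)
  have sub: "A \<subseteq> {..<n}" "B \<subseteq> {..<n}" using X Y by (auto simp: A_def B_def)
  define a b c where "a = card A" and "b = card B" and "c = card C"
  have cX: "card X = a + c" and cY: "card Y = b + c"
    unfolding XA YB a_def b_def c_def using dis fin by (simp_all add: card_Un_disjoint)
  have "card (A \<union> B \<union> C) = a + b + c"
    unfolding a_def b_def c_def using dis fin by (subst card_Un_disjoint; auto simp: card_Un_disjoint)+
  moreover have "card (A \<union> B \<union> C) \<le> card {..<n}"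
    using X Y by (intro card_mono) (auto simp: A_def B_def C_def)
  ultimately have abc: "a + b + c \<le> n" by simp
  define x where "x Z = (if Z \<in> H then 1 else 0 :: nat)" for Z
  have val: "adversary d n H Z = min (card Z) (min (d - 1) (n + 1 - card Z)) + x Z"
    if "Z \<subseteq> {..<n}" for Z
    using that by (simp add: adversary_def x_def)
  define h where "h k = min k (min (d - 1) (n + 1 - k))" for k
  \<comment> \<open>For linear arithmetic the minimum is split into upper bounds, used on the left
    side, and possible values, used on the right side.\<close>
  have h: "h k \<le> k \<and> h k \<le> d - 1 \<and> h k \<le> n + 1 - k"
    and h': "h k = k \<or> h k = d - 1 \<or> h k = n + 1 - k" for k
    by (auto simp: h_def min_def)
  show ?thesis
  proof (cases "c = 0")
    case True
    then have "C = {}" using fin by (simp add: c_def)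
    then have "A = X" "B = Y" using XA YB by auto
    then show ?thesis by (simp add: A_def[symmetric] B_def[symmetric])
  next
    case False
    \<comment> \<open>\<open>A\<close> and \<open>B\<close> cannot both be raised: they would
      coincide, but they are disjoint and \<open>A\<close> is nonempty.\<close>
    have "x A = 0 \<or> a = n + 1 - d \<and> x A = 1 \<and> x B = 0"
    proof (cases "A \<in> H")
      case True
      then have "B \<notin> H" using H[of A] H1[of A B] dis(1) d n by force
      then show ?thesis using True H[of A] by (simp add: x_def a_def)
    qed (simp add: x_def)
    moreover have "x B = 0 \<or> b = n + 1 - d \<and> x B = 1"
      using H[of B] by (auto simp: x_def b_def)
    ultimately have "h a + x A + (h b + x B) \<le> h (a + c) + h (b + c)"
      using False abc d n h[of a] h[of b] h'[of "a + c"] h'[of "b + c"]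
      by (elim disjE conjE) linarith+
    then show ?thesis
      using X Y sub by (simp add: A_def[symmetric] B_def[symmetric] val cX cY h_def a_def[symmetric] b_def[symmetric])
  qed
qed

lemma adversary_instance:
  assumes d: "d \<ge> 2" and n: "n \<ge> 2 * d"
    and H: "\<And>X. X \<in> H \<Longrightarrow> card X = n + 1 - d \<and> X \<subseteq> {..<n}" and H1: "\<And>X Y. X \<in> H \<Longrightarrow> Y \<in> H \<Longrightarrow> X = Y"
  shows "adversary d n H \<in> instances d n"
proof -
  have "{} \<notin> H" using H[of "{}"] n d by auto
  then have "adversary d n H {} = 0" by (simp add: adversary_def)
  moreover have "adversary d n H \<in> Pow {..<n} \<rightarrow>\<^sub>E {0..d}"
    using d by (auto simp: adversary_def)
  moreover have "posimodular {..<n} (\<lambda>X. real (adversary d n H X))"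
    unfolding posimodular_def of_nat_add[symmetric] of_nat_le_iff
    using posimodular_adversary_aux[OF d n H H1] by blast
  ultimately show ?thesis by (simp add: instances_def)
qed

text \<open>If a set of size \<open>n + 1 - d\<close> were never queried, raising it to
  \<open>d\<close> would leave the run unchanged, and with it an answer of at most
  \<open>d - 1\<close>.\<close>

lemma running_time_adversary:
  assumes P: "solves_maximization d P" and d: "d \<ge> 2" and n: "n \<ge> 2 * d" and T: "T \<ge> 1"
  shows "(n choose (d - 1)) * T \<le> worst_case_time d P n T"
proof -
  have inst: "adversary d n {} \<in> instances d n" using adversary_instance[OF d n] by blast
  have n1: "n \<ge> 1" using n d by simp
  obtain t s where r: "run (adversary d n {}) n T P (init_memory n) t s"
    and s0: "s 0 = adversary d n {} (set_at n s (s 1))"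
    using P inst n1 T unfolding solves_maximization_def by blast
  have lt: "s 0 \<le> d - 1" unfolding s0 by (auto simp: adversary_def set_at_def)
  obtain Q where Q: "finite Q" "card Q * T \<le> t" and
    agree: "\<And>g. (\<forall>X\<in>Q. X \<subseteq> {..<n} \<longrightarrow> g X = adversary d n {} X) \<Longrightarrow> run g n T P (init_memory n) t s"
    using run_queries[OF r] by blast
  let ?N = "{X. X \<subseteq> {..<n} \<and> card X = n + 1 - d}"
  have "?N \<subseteq> Q"
  proof (rule ccontr)
    assume "\<not> ?N \<subseteq> Q"
    then obtain X where X: "X \<subseteq> {..<n}" "card X = n + 1 - d" "X \<notin> Q" by auto
    have inst': "adversary d n {X} \<in> instances d n"
      by (rule adversary_instance[OF d n]) (use X in auto)
    obtain t' s' where r': "run (adversary d n {X}) n T P (init_memory n) t' s'"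
      and max: "is_maximizer n (adversary d n {X}) (set_at n s' (s' 1))"
      and s0': "s' 0 = adversary d n {X} (set_at n s' (s' 1))"
      using P inst' n1 T unfolding solves_maximization_def by blast
    have "run (adversary d n {X}) n T P (init_memory n) t s"
      using X(3) by (intro agree) (auto simp: adversary_def)
    with r' have "s' = s" using run_deterministic by blast
    moreover have "X \<noteq> {}" using X(2) n d by auto
    then have "adversary d n {X} X \<le> s' 0"
      using max X(1) unfolding s0' is_maximizer_def by blast
    moreover have "adversary d n {X} X = d" using X n d by (simp add: adversary_def)
    ultimately show False using lt d by simp
  qed
  then have "card ?N \<le> card Q" using Q(1) card_mono by blast
  moreover have "card ?N = n choose (d - 1)"
    using n_subsets[of "{..<n}" "n + 1 - d"] binomial_symmetric[of "n + 1 - d" n] n d by simp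
  ultimately have "(n choose (d - 1)) * T \<le> card Q * T" by simp
  also have "\<dots> \<le> t" by (rule Q(2))
  also have "\<dots> \<le> worst_case_time d P n T" by (rule worst_case_time_ge[OF inst r])
  finally show ?thesis .
qed

section \<open>Asymptotic form of the lower bound\<close>

lemma eventually_size_cost_filter:
  assumes "\<And>n T. n \<ge> N \<Longrightarrow> T \<ge> 1 \<Longrightarrow> Q (n, T)"
  shows "eventually Q size_cost_filter"
  unfolding size_cost_filter_def eventually_prod_filter
  by (rule exI[of _ "\<lambda>n. n \<ge> N"], rule exI[of _ "\<lambda>T. T \<ge> 1"])
    (auto simp: eventually_principal eventually_ge_at_top intro: assms)

lemma maximization_lower_bound:
  assumes P: "solves_maximization d P" and d: "d \<ge> 2"
  shows "(\<lambda>(n, T). real (worst_case_time d P n T))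
    \<in> \<Omega>[size_cost_filter](\<lambda>(n, T). real n ^ (d - 1) * real T)"
proof (rule landau_omega.bigI)
  \<comment> \<open>From \<open>(n / k) ^ k \<le> n choose k\<close> with
    \<open>k = d - 1\<close>.\<close>
  let ?c = "1 / real (d - 1) ^ (d - 1)"
  show "?c > 0" using d by simp
  show "\<forall>\<^sub>F x in size_cost_filter. ?c * norm (case x of (n, T) \<Rightarrow> real n ^ (d - 1) * real T)
     \<le> norm (case x of (n, T) \<Rightarrow> real (worst_case_time d P n T))"
  proof (rule eventually_size_cost_filter[of "2 * d"])
    fix n T :: nat assume n: "2 * d \<le> n" and T: "1 \<le> T"
    have "?c * (real n ^ (d - 1) * real T) = (real n / real (d - 1)) ^ (d - 1) * real T"
      by (simp add: power_divide)
    also have "\<dots> \<le> real (n choose (d - 1)) * real T"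
      using n d by (intro mult_right_mono binomial_ge_n_over_k_pow_k) auto
    also have "\<dots> = real ((n choose (d - 1)) * T)" by simp
    also have "\<dots> \<le> real (worst_case_time d P n T)"
      using running_time_adversary[OF P d n T] of_nat_le_iff by blast
    finally show "?c * norm (case (n, T) of (n, T) \<Rightarrow> real n ^ (d - 1) * real T)
     \<le> norm (case (n, T) of (n, T) \<Rightarrow> real (worst_case_time d P n T))" by simp
  qed
qed

section \<open>The algorithm\<close>

definition wp :: "(nat set \<Rightarrow> nat) \<Rightarrow> nat \<Rightarrow> nat \<Rightarrow> program \<Rightarrow> (nat \<Rightarrow> memory \<Rightarrow> bool) \<Rightarrow> memory \<Rightarrow> bool" where
  "wp f n T P Q s \<longleftrightarrow> (\<exists>t s'. run f n T P s t s' \<and> Q t s')"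

lemma wp_Const: "Q 1 (s(i := k)) \<Longrightarrow> wp f n T (Const i k) Q s"
  and wp_Add: "Q 1 (s(i := s j + s k)) \<Longrightarrow> wp f n T (Add i j k) Q s"
  and wp_Sub: "Q 1 (s(i := s j - s k)) \<Longrightarrow> wp f n T (Sub i j k) Q s"
  and wp_Load: "Q 1 (s(i := s (s j))) \<Longrightarrow> wp f n T (Load i j) Q s"
  and wp_Store: "Q 1 (s(s i := s j)) \<Longrightarrow> wp f n T (Store i j) Q s"
  and wp_Query: "Q T (s(i := f (set_at n s (s j)))) \<Longrightarrow> wp f n T (Query i j) Q s"
  unfolding wp_def by (blast intro: run.intros)+

lemma wp_Seq: "wp f n T P (\<lambda>t. wp f n T R (\<lambda>u. Q (t + u))) s \<Longrightarrow> wp f n T (Seq P R) Q s"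
  unfolding wp_def by (blast intro: run.intros)

lemma wp_If:
  "\<lbrakk>s i \<noteq> 0 \<Longrightarrow> wp f n T P (\<lambda>t. Q (1 + t)) s; s i = 0 \<Longrightarrow> wp f n T R (\<lambda>t. Q (1 + t)) s\<rbrakk>
    \<Longrightarrow> wp f n T (If i P R) Q s"
  unfolding wp_def by (cases "s i = 0") (blast intro: run.intros)+

lemmas wp_intros = wp_Const wp_Add wp_Sub wp_Load wp_Store wp_Query wp_Seq wp_If

lemma wp_mono: "wp f n T P Q s \<Longrightarrow> (\<And>t s'. Q t s' \<Longrightarrow> R t s') \<Longrightarrow> wp f n T P R s"
  unfolding wp_def by blast

text \<open>The rules produce start states as chains of updates; the equation allows a fact about an
  explicitly named memory to be applied there.\<close>

lemma wp_change:
  "\<lbrakk>wp f n T P Q s; s' = s; \<And>t s''. Q t s'' \<Longrightarrow> R t s''\<rbrakk> \<Longrightarrow> wp f n T P R s'"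
  unfolding wp_def by blast

text \<open>Amortised rule for a loop that counts cell \<open>i\<close> down: an iteration may
  exceed \<open>T * K\<close> by as much as it raises \<open>T * \<phi>\<close>, and these raises
  telescope. The additional \<open>m + 1\<close> pays for the tests, the last of which
  fails.\<close>

lemma wp_While:
  assumes body: "\<And>j s. j < m \<Longrightarrow> I (Suc j) s \<Longrightarrow> s i = Suc j \<Longrightarrow>
      wp f n T P (\<lambda>t s'. I j s' \<and> s' i = j \<and> t + T * \<phi> s \<le> T * (K + \<phi> s')) s"
    and T: "T \<ge> 1" and "I m s" "s i = m"
  shows "wp f n T (While i P) (\<lambda>t s'. I 0 s' \<and> t + T * \<phi> s \<le> T * ((K + 1) * m + 1 + \<phi> s')) s"
  using assms(1,3,4)
proof (induction m arbitrary: s)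
  case 0
  then have "run f n T (While i P) s 1 s" by (intro run_While_False)
  with 0 T show ?case by (auto simp: wp_def intro!: exI[of _ 1] exI[of _ s])
next
  case (Suc m)
  obtain t s1 where 1: "run f n T P s t s1" "I m s1" "s1 i = m" "t + T * \<phi> s \<le> T * (K + \<phi> s1)"
    using Suc.prems unfolding wp_def by blast
  obtain u s2 where 2: "run f n T (While i P) s1 u s2" "I 0 s2"
      "u + T * \<phi> s1 \<le> T * ((K + 1) * m + 1 + \<phi> s2)"
    using Suc.IH[of s1] Suc.prems(1) 1(2,3) unfolding wp_def by auto
  have "run f n T (While i P) s (1 + t + u) s2"
    using Suc.prems(3) 1(1) 2(1) by (intro run_While_True) auto
  moreover have "1 + t + u + T * \<phi> s \<le> T * ((K + 1) * Suc m + 1 + \<phi> s2)"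
    using 1(4) 2(3) T by (simp add: algebra_simps)
  ultimately show ?case using 2(2) unfolding wp_def by blast
qed

text \<open>
  Memory layout, besides the cells 0 and 1 fixed by the problem: cells 2, 3 and 4 hold the
  constants 1, the address \<open>base d\<close> of the current set, and 0; cell 5 the best value found so
  far; cell 6 the number of elements \<open>c\<close> tried for the current set \<open>B\<close>; cells 7 to 10 are
  temporary; \<open>index_cell k\<close> and \<open>saved_cell k\<close> belong to the loop at nesting level \<open>k\<close>. The
  current set is followed by the best set found so far, whose address is in cell 1.
\<close>

definition base :: "nat \<Rightarrow> nat" where "base d = 11 + 2 * d"
definition index_cell :: "nat \<Rightarrow> nat" where "index_cell k = 11 + 2 * k"
definition saved_cell :: "nat \<Rightarrow> nat" where "saved_cell k = 12 + 2 * k"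

section \<open>The search program\<close>

definition skip :: program where "skip = Const 9 0"

definition copy_set :: program where
  "copy_set = Seq (Add 9 0 4) (While 9 (Seq (Sub 9 9 2) (Seq (Add 7 3 9) (Seq (Load 10 7)
     (Seq (Add 7 1 9) (Store 7 10))))))"

definition fill_sets :: program where
  "fill_sets = Seq (Add 9 0 4) (While 9 (Seq (Sub 9 9 2) (Seq (Add 7 3 9) (Seq (Store 7 2)
     (Seq (Add 7 1 9) (Store 7 2))))))"

definition clear_set :: program where
  "clear_set = Seq (Add 9 0 4) (While 9 (Seq (Sub 9 9 2) (Seq (Add 7 3 9) (Store 7 4))))"

definition test_set :: program where
  "test_set = Seq (Query 8 3) (Seq (Sub 9 8 5) (If 9 (Seq (Add 5 8 4) copy_set) skip))"

text \<open>
  \<open>for_elements k v body\<close> runs \<open>body\<close> with each element in turn inserted into the current set if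
  \<open>v = 2\<close> and removed from it if \<open>v = 4\<close>.
\<close>

definition for_elements :: "nat \<Rightarrow> nat \<Rightarrow> program \<Rightarrow> program" where
  "for_elements k v body = Seq (Add (index_cell k) 0 4) (While (index_cell k)
     (Seq (Sub (index_cell k) (index_cell k) 2)
     (Seq (Add 7 3 (index_cell k))
     (Seq (Load (saved_cell k) 7)
     (Seq (Store 7 v)
     (Seq body
     (Seq (Add 7 3 (index_cell k))
     (Store 7 (saved_cell k)))))))))"

primrec nested_for :: "nat \<Rightarrow> nat \<Rightarrow> nat \<Rightarrow> program \<Rightarrow> program" where
  "nested_for k v 0 body = body"
| "nested_for k v (Suc j) body = for_elements (k + j) v (nested_for k v j body)"

text \<open>Runs with \<open>B \<union> {c}\<close> as current set. By truncated subtraction, cell 8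
  is nonzero iff the value is at least \<open>d - 1\<close>, and cell 9 iff at most \<open>d\<close>
  elements were tried before. This cap keeps the linear search for \<open>q\<close> from being made
  for every \<open>c\<close>.\<close>

definition extend_set :: "nat \<Rightarrow> program" where
  "extend_set d = Seq (Query 8 3) (Seq (Const 9 (d - 2)) (Seq (Sub 8 8 9)
     (If 8 (Seq (Const 9 (d + 1)) (Seq (Sub 9 9 6)
       (If 9 (Seq (Add 6 6 2) (for_elements 0 2 test_set)) skip))) skip)))"

text \<open>The first pass serves the case \<open>cosmall\<close> of
  \<open>maximizer_search_space\<close>, the second the case \<open>greedy\<close>. Removing
  \<open>d - 1\<close> elements never yields the whole ground set, which is therefore queried first;
  this also gives a nonempty best set to start with.\<close>

definition maximization_program :: "nat \<Rightarrow> program" where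
  "maximization_program d =
     Seq (Const 2 1) (Seq (Const 3 (base d)) (Seq (Add 1 3 0) (Seq fill_sets (Seq (Query 5 1)
     (Seq (nested_for 0 4 (d - 1) test_set)
     (Seq clear_set
     (Seq (nested_for 2 2 (d - 2) (Seq (Const 6 0) (for_elements 1 2 (extend_set d))))
     (Add 0 5 4))))))))"

definition update :: "nat \<Rightarrow> nat \<Rightarrow> nat set \<Rightarrow> nat set" where
  "update v i S = (if v = 2 then insert i S else S - {i})"

section \<open>Invariants and amortised costs\<close>

locale maximization_machine =
  fixes f :: "nat set \<Rightarrow> nat" and n T d :: nat
  assumes d: "d \<ge> 2" and n: "n \<ge> 1" and T: "T \<ge> 1" and f_empty: "f {} = 0"
begin

abbreviation A where "A \<equiv> base d"

text \<open>The cells that programs with loop levels below \<open>k\<close> may change: temporaries,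
  cells of these loops, and the best set. The current set and the cells of enclosing loops are
  protected.\<close>

definition scratch :: "nat \<Rightarrow> nat set" where
  "scratch k = {5..<11 + 2 * k} \<union> {A + n..<A + 2 * n}"

definition ready :: "memory \<Rightarrow> bool" where
  "ready s \<longleftrightarrow> s 0 = n \<and> s 1 = A + n \<and> s 2 = 1 \<and> s 3 = A \<and> s 4 = 0 \<and>
     set_at n s (A + n) \<noteq> {} \<and> s 5 = f (set_at n s (A + n))"

text \<open>
  Hoare triples for programs that leave the current set \<open>S\<close> unchanged. The running time is
  \<open>T * K\<close>, amortised by the potential \<open>\<Phi>\<close>, which like the pre- and postcondition depends
  on the best value and the counter.
\<close>

definition triple where
  "triple k \<Phi> S P body Q K \<longleftrightarrow> (\<forall>s. ready s \<and> set_at n s A = S \<and> P (s 5) (s 6) \<longrightarrow>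
     wp f n T body (\<lambda>t s'. ready s' \<and> (\<forall>a. a \<notin> scratch k \<longrightarrow> s' a = s a) \<and> Q (s' 5) (s' 6) \<and>
       t + T * \<Phi> (s 5) (s 6) \<le> T * (K + \<Phi> (s' 5) (s' 6))) s)"

lemma tripleD:
  assumes "triple k \<Phi> S P body Q K" "ready s" "set_at n s A = S" "P (s 5) (s 6)"
  shows "wp f n T body (\<lambda>t s'. ready s' \<and> (\<forall>a. a \<notin> scratch k \<longrightarrow> s' a = s a) \<and> Q (s' 5) (s' 6) \<and>
       t + T * \<Phi> (s 5) (s 6) \<le> T * (K + \<Phi> (s' 5) (s' 6))) s"
  using assms unfolding triple_def by blast

text \<open>The last premise exchanges potentials: \<open>K\<close> plus the increase of
  \<open>\<Phi>\<close> is at most \<open>K'\<close> plus the increase of \<open>\<Psi>\<close>,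
  rearranged to avoid subtraction.\<close>

lemma triple_conseq:
  assumes "triple k \<Phi> S P body Q K"
    and "\<And>b u. P' b u \<Longrightarrow> P b u" and "\<And>b u. Q b u \<Longrightarrow> Q' b u"
    and "\<And>b u b' u'. P' b u \<Longrightarrow> Q b' u' \<Longrightarrow> K + \<Phi> b' u' + \<Psi> b u \<le> K' + \<Psi> b' u' + \<Phi> b u"
  shows "triple k \<Psi> S P' body Q' K'"
  unfolding triple_def
proof safe
  fix s assume s: "ready s" "S = set_at n s A" "P' (s 5) (s 6)"
  show "wp f n T body (\<lambda>t s'. ready s' \<and> (\<forall>a. a \<notin> scratch k \<longrightarrow> s' a = s a) \<and> Q' (s' 5) (s' 6) \<and>
       t + T * \<Psi> (s 5) (s 6) \<le> T * (K' + \<Psi> (s' 5) (s' 6))) s"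
  proof (rule wp_mono)
    show "wp f n T body (\<lambda>t s'. ready s' \<and> (\<forall>a. a \<notin> scratch k \<longrightarrow> s' a = s a) \<and> Q (s' 5) (s' 6) \<and>
       t + T * \<Phi> (s 5) (s 6) \<le> T * (K + \<Phi> (s' 5) (s' 6))) s"
      using assms(1,2) s unfolding triple_def by blast
  next
    fix t s' assume *: "ready s' \<and> (\<forall>a. a \<notin> scratch k \<longrightarrow> s' a = s a) \<and> Q (s' 5) (s' 6) \<and>
       t + T * \<Phi> (s 5) (s 6) \<le> T * (K + \<Phi> (s' 5) (s' 6))"
    then have "T * (K + \<Phi> (s' 5) (s' 6) + \<Psi> (s 5) (s 6)) \<le> T * (K' + \<Psi> (s' 5) (s' 6) + \<Phi> (s 5) (s 6))"
      using assms(4) s(3) by (intro mult_left_mono) auto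
    with * have "t + T * \<Psi> (s 5) (s 6) \<le> T * (K' + \<Psi> (s' 5) (s' 6))"
      by (simp add: algebra_simps)
    with * assms(3) show "ready s' \<and> (\<forall>a. a \<notin> scratch k \<longrightarrow> s' a = s a) \<and> Q' (s' 5) (s' 6) \<and>
       t + T * \<Psi> (s 5) (s 6) \<le> T * (K' + \<Psi> (s' 5) (s' 6))"
      by blast
  qed
qed

lemma set_at_cong: "(\<And>v. v < n \<Longrightarrow> s (a + v) = s' (a + v)) \<Longrightarrow> set_at n s a = set_at n s' a"
  by (auto simp: set_at_def)

lemma ready_cong:
  assumes "ready s" "\<And>a. a \<le> 5 \<Longrightarrow> s' a = s a" "\<And>a. a \<in> {A + n..<A + 2 * n} \<Longrightarrow> s' a = s a"
  shows "ready s'"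
proof -
  have "set_at n s' (A + n) = set_at n s (A + n)"
    using assms(3) by (intro set_at_cong) auto
  with assms(1) show ?thesis by (simp add: ready_def assms(2))
qed

text \<open>\<open>I\<close> is indexed by the number of elements still to come. An iteration adds 6
  instructions and a test to the body; the initialisation and the final test cost at most
  \<open>2 * T * n\<close>. Together this makes \<open>K + 9\<close>.\<close>

lemma triple_for_elements:
  assumes k: "k < d" and v: "v = 2 \<or> v = 4"
    and body: "\<And>j. j < n \<Longrightarrow> triple k \<Phi> (update v j S) (I (Suc j)) body (I j) K"
  shows "triple (Suc k) \<Phi> S (I n) (for_elements k v body) (I 0) ((K + 9) * n)"
  unfolding triple_def
proof safe
  fix s assume s: "ready s" "S = set_at n s A" "I n (s 5) (s 6)"
  let ?i = "index_cell k" and ?o = "saved_cell k"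
  have lay: "?i < A" "?o < A" "?i \<noteq> ?o" "?i \<notin> scratch k" "?o \<notin> scratch k" "7 \<in> scratch k"
    "?i \<in> scratch (Suc k)" "?o \<in> scratch (Suc k)" "scratch k \<subseteq> scratch (Suc k)" "?i > 10" "?o > 10" "A > 10"
    using k by (auto simp: index_cell_def saved_cell_def base_def scratch_def)
  define J where "J j s' \<longleftrightarrow> ready s' \<and> (\<forall>a. a \<notin> scratch (Suc k) \<longrightarrow> s' a = s a) \<and> I j (s' 5) (s' 6)" for j s'
  let ?\<phi> = "\<lambda>s. \<Phi> (s 5) (s 6)"
  have loop: "wp f n T (While ?i
     (Seq (Sub ?i ?i 2) (Seq (Add 7 3 ?i) (Seq (Load ?o 7) (Seq (Store 7 v) (Seq body
     (Seq (Add 7 3 ?i) (Store 7 ?o))))))))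
     (\<lambda>t s'. J 0 s' \<and> t + T * ?\<phi> s1 \<le> T * ((K + 6 + 1) * n + 1 + ?\<phi> s')) s1"
    if "J n s1" "s1 ?i = n" for s1
  proof (rule wp_While[OF _ T])
    fix j s2 assume j: "j < n" and J: "J (Suc j) s2" and i: "s2 ?i = Suc j"
    from J have r: "ready s2" by (simp add: J_def)
    define s3 where "s3 = s2(?i := j, 7 := A + j, ?o := s2 (A + j), A + j := s2 v)"
    have r3: "ready s3"
      by (rule ready_cong[OF r]) (use lay j in \<open>auto simp: s3_def\<close>)
    have S2: "set_at n s2 A = S" unfolding s(2)
      by (rule set_at_cong) (use J lay in \<open>auto simp: J_def scratch_def base_def\<close>)
    have "set_at n s3 A = update v j (set_at n s2 A)"
      using r v lay j unfolding s3_def by (auto simp: set_at_def update_def ready_def)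
    moreover have I3: "s3 5 = s2 5" "s3 6 = s2 6" "I (Suc j) (s3 5) (s3 6)"
      using J lay by (auto simp: s3_def J_def)
    ultimately have "wp f n T body (\<lambda>t s'. ready s' \<and> (\<forall>a. a \<notin> scratch k \<longrightarrow> s' a = s3 a) \<and> I j (s' 5) (s' 6) \<and>
       t + T * ?\<phi> s3 \<le> T * (K + ?\<phi> s')) s3"
      using body[OF j] r3 unfolding triple_def S2 by blast
    \<comment> \<open>Writing the saved value back restores the current set, so \<open>J\<close>
      holds again after the last two instructions.\<close>
    then have "wp f n T body (\<lambda>u s'. J j (s'(7 := A + j, A + j := s2 (A + j))) \<and> s' 3 = A \<and> s' ?i = j \<and>
        s' ?o = s2 (A + j) \<and> u + 6 + T * ?\<phi> s2 \<le> T * (K + 6 + ?\<phi> s')) s3"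
    proof (rule wp_mono, goal_cases)
      case (1 u s')
      then have r': "ready s'" and fr: "\<And>a. a \<notin> scratch k \<Longrightarrow> s' a = s3 a" by auto
      have "ready (s'(7 := A + j, A + j := s2 (A + j)))"
        by (rule ready_cong[OF r']) (use lay j in auto)
      moreover have "(s'(7 := A + j, A + j := s2 (A + j))) a = s a" if "a \<notin> scratch (Suc k)" for a
      proof -
        have "a \<notin> scratch k" "a \<noteq> ?i" "a \<noteq> ?o" "a \<noteq> 7" using that lay by auto
        with fr[of a] J that show ?thesis by (auto simp: s3_def J_def)
      qed
      ultimately have "J j (s'(7 := A + j, A + j := s2 (A + j)))"
        using 1 lay by (auto simp: J_def)
      moreover have "6 \<le> T * 6" using T by simp
      ultimately show ?case
        using 1 fr[of ?i] fr[of ?o] r' lay I3 by (auto simp: s3_def ready_def algebra_simps)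
    qed
    then show "wp f n T (Seq (Sub ?i ?i 2) (Seq (Add 7 3 ?i) (Seq (Load ?o 7) (Seq (Store 7 v) (Seq body
     (Seq (Add 7 3 ?i) (Store 7 ?o)))))))
       (\<lambda>t s'. J j s' \<and> s' ?i = j \<and> t + T * ?\<phi> s2 \<le> T * (K + 6 + ?\<phi> s')) s2"
      apply (intro wp_Seq wp_Sub wp_Add wp_Load wp_Store)
      apply (erule wp_change)
      subgoal using r i lay v by (auto simp: s3_def ready_def)
      subgoal for t s' using lay
        apply (intro wp_Seq wp_Add wp_Store) by (simp add: algebra_simps)
      done
  qed (use that in auto)
  have W: "wp f n T (While ?i
     (Seq (Sub ?i ?i 2) (Seq (Add 7 3 ?i) (Seq (Load ?o 7) (Seq (Store 7 v) (Seq body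
     (Seq (Add 7 3 ?i) (Store 7 ?o))))))))
     (\<lambda>t s'. J 0 s' \<and> t + T * ?\<phi> (s(?i := n)) \<le> T * ((K + 6 + 1) * n + 1 + ?\<phi> s')) (s(?i := n))"
  proof (rule loop)
    have "ready (s(?i := n))"
      by (rule ready_cong[OF s(1)]) (use lay in auto)
    then show "J n (s(?i := n))" using s(3) lay by (auto simp: J_def)
  qed simp
  have le: "1 + T * ((K + 6 + 1) * n + 1 + x) \<le> T * ((K + 9) * n + x)" for x
  proof -
    have "1 + T \<le> T * 2" using T by simp
    also have "\<dots> \<le> T * (2 * n)" using n by (intro mult_left_mono) auto
    finally show ?thesis by (simp add: algebra_simps)
  qed
  show "wp f n T (for_elements k v body) (\<lambda>t s'. ready s' \<and> (\<forall>a. a \<notin> scratch (Suc k) \<longrightarrow> s' a = s a) \<and> I 0 (s' 5) (s' 6) \<and>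
       t + T * ?\<phi> s \<le> T * ((K + 9) * n + ?\<phi> s')) s"
    unfolding for_elements_def
  proof (intro wp_Seq wp_Add, rule wp_change[OF W], goal_cases)
    case 1
    then show ?case using s(1) by (simp add: ready_def)
  next
    case (2 t s')
    then have "1 + t + T * ?\<phi> s \<le> 1 + T * ((K + 6 + 1) * n + 1 + ?\<phi> s')"
      using lay by simp
    with le[of "?\<phi> s'"] 2 show ?case
      unfolding J_def by (blast intro: order_trans)
  qed
qed

section \<open>Nested loops and the sets they have tested\<close>

primrec for_all_updates where
  "for_all_updates v 0 R S b = R S b"
| "for_all_updates v (Suc j) R S b = (\<forall>i<n. for_all_updates v j R (update v i S) b)"

lemma for_all_updates_mono:
  assumes "for_all_updates v j R S b" "b \<le> b'" "\<And>S b b'. R S b \<Longrightarrow> b \<le> b' \<Longrightarrow> R S b'"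
  shows "for_all_updates v j R S b'"
  using assms(1,2)
proof (induction j arbitrary: S)
  case 0
  then show ?case using assms(3)[of S b b'] by simp
qed auto

text \<open>Quantifying over \<open>b0\<close> expresses that the best value never decreases,
  although each assertion sees only one state. \<open>U\<close> is an invariant of the
  counter.\<close>

definition records where
  "records k \<Phi> U body R K \<longleftrightarrow>
     (\<forall>S b0. triple k \<Phi> S (\<lambda>b u. b0 \<le> b \<and> U u) body (\<lambda>b u. b0 \<le> b \<and> U u \<and> R S b) K)"

lemma records_weaken:
  assumes "records k \<Phi> U body R K" "K \<le> K'"
  shows "records k \<Phi> U body R K'"
  unfolding records_def
proof (intro allI)
  fix S b0
  show "triple k \<Phi> S (\<lambda>b u. b0 \<le> b \<and> U u) body (\<lambda>b u. b0 \<le> b \<and> U u \<and> R S b) K'"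
    by (rule triple_conseq[OF assms(1)[unfolded records_def, rule_format, of S b0]]) (use assms(2) in auto)
qed

text \<open>Monotonicity of \<open>R\<close> preserves what was established for earlier elements
  while the best value keeps rising.\<close>

lemma records_for_elements:
  assumes k: "k < d" and v: "v = 2 \<or> v = 4"
    and body: "records k \<Phi> U body R K" and mono: "\<And>S b b'. R S b \<Longrightarrow> b \<le> b' \<Longrightarrow> R S b'"
  shows "records (Suc k) \<Phi> U (for_elements k v body) (\<lambda>S b. \<forall>i<n. R (update v i S) b) ((K + 9) * n)"
  unfolding records_def
proof (intro allI)
  fix S b0
  define I where "I j b u \<longleftrightarrow> b0 \<le> b \<and> U u \<and> (\<forall>i. j \<le> i \<and> i < n \<longrightarrow> R (update v i S) b)" for j b u
  have step: "triple k \<Phi> (update v j S) (I (Suc j)) body (I j) K" if "j < n" for j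
    unfolding triple_def
  proof safe
    fix s assume s: "ready s" "set_at n s A = update v j S" "I (Suc j) (s 5) (s 6)"
    have "wp f n T body (\<lambda>t s'. ready s' \<and> (\<forall>a. a \<notin> scratch k \<longrightarrow> s' a = s a) \<and>
        (s 5 \<le> s' 5 \<and> U (s' 6) \<and> R (update v j S) (s' 5)) \<and>
        t + T * \<Phi> (s 5) (s 6) \<le> T * (K + \<Phi> (s' 5) (s' 6))) s"
    proof -
      have "triple k \<Phi> (update v j S) (\<lambda>b u. s 5 \<le> b \<and> U u) body
          (\<lambda>b u. s 5 \<le> b \<and> U u \<and> R (update v j S) b) K"
        using body unfolding records_def by blast
      then show ?thesis using s unfolding triple_def I_def by blast
    qed
    then show "wp f n T body (\<lambda>t s'. ready s' \<and> (\<forall>a. a \<notin> scratch k \<longrightarrow> s' a = s a) \<and> I j (s' 5) (s' 6) \<and>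
        t + T * \<Phi> (s 5) (s 6) \<le> T * (K + \<Phi> (s' 5) (s' 6))) s"
    proof (rule wp_mono)
      fix t s'
      assume *: "ready s' \<and> (\<forall>a. a \<notin> scratch k \<longrightarrow> s' a = s a) \<and>
        (s 5 \<le> s' 5 \<and> U (s' 6) \<and> R (update v j S) (s' 5)) \<and>
        t + T * \<Phi> (s 5) (s 6) \<le> T * (K + \<Phi> (s' 5) (s' 6))"
      have "R (update v i S) (s' 5)" if "j \<le> i" "i < n" for i
      proof (cases "i = j")
        case False
        then have "R (update v i S) (s 5)" using that s(3) by (simp add: I_def)
        with * mono show ?thesis by blast
      qed (use * in simp)
      with * s(3) show "ready s' \<and> (\<forall>a. a \<notin> scratch k \<longrightarrow> s' a = s a) \<and> I j (s' 5) (s' 6) \<and>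
        t + T * \<Phi> (s 5) (s 6) \<le> T * (K + \<Phi> (s' 5) (s' 6))"
        unfolding I_def by auto
    qed
  qed
  show "triple (Suc k) \<Phi> S (\<lambda>b u. b0 \<le> b \<and> U u) (for_elements k v body)
     (\<lambda>b u. b0 \<le> b \<and> U u \<and> (\<forall>i<n. R (update v i S) b)) ((K + 9) * n)"
    by (rule triple_conseq[OF triple_for_elements[OF k v step]]) (auto simp: I_def)
qed

text \<open>Each level multiplies the cost by \<open>n\<close> and the constant by 10, since
  \<open>K + 9 \<le> 10 * K\<close> for \<open>K \<ge> 1\<close>.\<close>

lemma records_nested_for:
  assumes "k + j \<le> d" and v: "v = 2 \<or> v = 4"
    and body: "records k \<Phi> U body R (c * n ^ e)" and mono: "\<And>S b b'. R S b \<Longrightarrow> b \<le> b' \<Longrightarrow> R S b'"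
    and c: "c \<ge> 1"
  shows "records (k + j) \<Phi> U (nested_for k v j body) (for_all_updates v j R) (10 ^ j * c * n ^ (e + j))"
  using assms(1)
proof (induction j)
  case 0
  then show ?case using body by simp
next
  case (Suc j)
  have "(10 ^ j * c * n ^ (e + j) + 9) * n \<le> 10 ^ Suc j * c * n ^ (e + Suc j)"
  proof -
    have "1 \<le> 10 ^ j * c * n ^ (e + j)" using c n by (simp add: Suc_le_eq)
    then have "(10 ^ j * c * n ^ (e + j) + 9) * n \<le> (10 * (10 ^ j * c * n ^ (e + j))) * n"
      by (intro mult_right_mono) auto
    then show ?thesis by (simp add: mult_ac)
  qed
  moreover have "records (Suc (k + j)) \<Phi> U (for_elements (k + j) v (nested_for k v j body))
      (\<lambda>S b. \<forall>i<n. for_all_updates v j R (update v i S) b) ((10 ^ j * c * n ^ (e + j) + 9) * n)"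
    by (rule records_for_elements[OF _ v]) (use Suc for_all_updates_mono[OF _ _ mono] in auto)
  ultimately show ?case
    using records_weaken by simp
qed

section \<open>Testing a set and storing improvements\<close>

text \<open>A copy costs about \<open>6 * n\<close> steps, but only happens when the best value
  \<open>b\<close> grows by at least 1; the growth of this potential pays for it.\<close>

definition copy_potential :: "nat \<Rightarrow> nat \<Rightarrow> nat" where
  "copy_potential b u = 10 * n * b"

lemma wp_copy_set:
  assumes "s 0 = n" "s 1 = A + n" "s 2 = 1" "s 3 = A" "s 4 = 0"
  shows "wp f n T copy_set (\<lambda>t s'. (\<forall>a. a \<notin> {7, 9, 10} \<union> {A + n..<A + 2 * n} \<longrightarrow> s' a = s a) \<and>
    set_at n s' (A + n) = set_at n s A \<and> t \<le> T * (6 * n + 2)) s"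
proof -
  define J where "J j s' \<longleftrightarrow> (\<forall>a. a \<notin> {7, 9, 10} \<union> {A + n..<A + 2 * n} \<longrightarrow> s' a = s a) \<and>
    (\<forall>i. j \<le> i \<and> i < n \<longrightarrow> s' (A + n + i) = s (A + i))" for j s'
  have A: "A > 10" by (simp add: base_def)
  have W: "wp f n T (While 9 (Seq (Sub 9 9 2) (Seq (Add 7 3 9) (Seq (Load 10 7)
     (Seq (Add 7 1 9) (Store 7 10))))))
     (\<lambda>t s'. J 0 s' \<and> t + T * 0 \<le> T * ((5 + 1) * n + 1 + 0)) (s(9 := n))"
  proof (rule wp_While[OF _ T])
    fix j s2 assume j: "j < n" and J: "J (Suc j) s2" and i: "s2 9 = Suc j"
    then have r: "s2 1 = A + n" "s2 2 = 1" "s2 3 = A" using assms A by (simp_all add: J_def)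
    have eq: "s2(9 := j, 7 := A + j, 10 := s2 (A + j), 7 := A + n + j, A + n + j := s2 (A + j)) =
       s2(9 := s2 9 - s2 2, 7 := s2 3 + (s2 9 - s2 2), 10 := s2 (s2 3 + (s2 9 - s2 2)),
         7 := s2 1 + (s2 9 - s2 2), s2 1 + (s2 9 - s2 2) := s2 (s2 3 + (s2 9 - s2 2)))"
      using r i by simp
    have Aj: "s2 (A + j) = s (A + j)" using J A j by (simp add: J_def)
    have "J j (s2(9 := j, 7 := A + j, 10 := s2 (A + j), 7 := A + n + j, A + n + j := s2 (A + j)))"
      unfolding Aj using J A j by (auto simp: J_def Suc_le_eq)
    moreover have "5 \<le> T * 5" using T by simp
    ultimately show "wp f n T (Seq (Sub 9 9 2) (Seq (Add 7 3 9) (Seq (Load 10 7)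
       (Seq (Add 7 1 9) (Store 7 10)))))
       (\<lambda>t s'. J j s' \<and> s' 9 = j \<and> t + T * 0 \<le> T * (5 + 0)) s2"
      using r i A by (intro wp_intros) simp
  qed (use A in \<open>auto simp: J_def\<close>)
  show ?thesis
    unfolding copy_set_def
  proof (intro wp_Seq wp_Add, rule wp_change[OF W], goal_cases)
    case 1
    then show ?case using assms by simp
  next
    case (2 t s')
    then have "set_at n s' (A + n) = set_at n s A"
      by (auto simp: J_def set_at_def)
    then show ?case using 2 T by (simp add: J_def)
  qed
qed

lemma records_test_set: "records 0 copy_potential U test_set (\<lambda>S b. f S \<le> b) 10"
  unfolding records_def triple_def
proof (intro allI impI)
  fix S b0 s assume s: "ready s \<and> set_at n s A = S \<and> b0 \<le> s 5 \<and> U (s 6)"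
  let ?Q = "\<lambda>t s'. ready s' \<and> (\<forall>a. a \<notin> scratch 0 \<longrightarrow> s' a = s a) \<and> (b0 \<le> s' 5 \<and> U (s' 6) \<and> f S \<le> s' 5) \<and>
    t + T * copy_potential (s 5) (s 6) \<le> T * (10 + copy_potential (s' 5) (s' 6))"
  have r: "s 1 = A + n" "s 2 = 1" "s 3 = A" "s 4 = 0" and S: "set_at n s A = S" using s by (auto simp: ready_def)
  have A: "A > 10" by (simp add: base_def)
  have sc: "a \<in> scratch 0" if "5 \<le> a" "a \<le> 10" for a using that by (simp add: scratch_def)
  show "wp f n T test_set ?Q s"
    unfolding test_set_def
  proof (intro wp_Seq wp_Query wp_Sub wp_If wp_Add, goal_cases)
    case 1
    let ?s = "s(8 := f (set_at n s (s 3)), 9 := f (set_at n s (s 3)) - s 5, 5 := f (set_at n s (s 3)))"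
    from 1 have better: "s 5 < f S" using r S by simp
    have W: "wp f n T copy_set (\<lambda>t s'. (\<forall>a. a \<notin> {7, 9, 10} \<union> {A + n..<A + 2 * n} \<longrightarrow> s' a = ?s a) \<and>
      set_at n s' (A + n) = set_at n ?s A \<and> t \<le> T * (6 * n + 2)) ?s"
      by (rule wp_copy_set) (use s in \<open>auto simp: ready_def\<close>)
    have S': "set_at n ?s A = S" unfolding S[symmetric]
      by (rule set_at_cong) (use A in simp)
    show ?case
    proof (rule wp_change[OF W], goal_cases)
      case 1
      then show ?case using r by auto
    next
      case (2 t s')
      then have fr: "\<And>a. a \<notin> {7, 9, 10} \<union> {A + n..<A + 2 * n} \<Longrightarrow> s' a = ?s a"
        and out: "set_at n s' (A + n) = S" and t: "t \<le> T * (6 * n + 2)" using S' by auto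
      have s'5: "s' 5 = f S" using fr[of 5] A r S by simp
      \<comment> \<open>\<open>f {} = 0\<close> rules out the empty set as an improvement.\<close>
      have "S \<noteq> {}" using better f_empty by auto
      then have "ready s'" using fr[of 0] fr[of 1] fr[of 2] fr[of 3] fr[of 4] out s'5 s A
        by (auto simp: ready_def)
      moreover have "s' a = s a" if "a \<notin> scratch 0" for a
        using fr[of a] sc[of a] that A by (auto simp: scratch_def)
      moreover have "s' 6 = s 6" using fr[of 6] A by simp
      moreover have "T + (1 + (1 + (1 + t))) + T * copy_potential (s 5) (s 6) \<le> T * (10 + copy_potential (s' 5) (s' 6))"
      proof -
        have "6 * n + copy_potential (s 5) (s 6) \<le> 10 * n * (s 5 + 1)" by (simp add: copy_potential_def)
        also have "\<dots> \<le> copy_potential (s' 5) (s' 6)"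
          unfolding copy_potential_def s'5 using better by (intro mult_left_mono) auto
        finally have "T * (6 * n + copy_potential (s 5) (s 6) + 10) \<le> T * (10 + copy_potential (s' 5) (s' 6))"
          by (intro mult_left_mono) auto
        with t T show ?thesis by (simp add: algebra_simps)
      qed
      ultimately show ?case using s better s'5 by simp
    qed
  next
    case 2
    let ?s = "s(8 := f S, 9 := 0)"
    have "ready ?s" by (rule ready_cong[of s]) (use s A in auto)
    moreover have "s 5 \<ge> f S" using 2 r S by simp
    ultimately show ?case
      unfolding skip_def using s r S T sc[of 8] sc[of 9]
      by (intro wp_Const) (auto simp: algebra_simps)
  qed
qed

section \<open>Greedy extension\<close>

text \<open>A search for \<open>q\<close> costs \<open>(10 + 9) * n\<close> and raises the counter
  \<open>u\<close> by one, which pays for it.\<close>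

definition extend_potential :: "nat \<Rightarrow> nat \<Rightarrow> nat" where
  "extend_potential b u = copy_potential b u + 19 * n * u"

lemma triple_extend_set:
  "triple 1 extend_potential S (\<lambda>b u. b = b0 \<and> u = u0) (extend_set d)
    (\<lambda>b u. b0 \<le> b \<and> (u = u0 \<and> (f S < d - 1 \<or> d < u0) \<or>
       u = Suc u0 \<and> u0 \<le> d \<and> d - 1 \<le> f S \<and> (\<forall>q<n. f (insert q S) \<le> b))) 10"
  unfolding triple_def
proof (intro allI impI)
  fix s assume s: "ready s \<and> set_at n s A = S \<and> s 5 = b0 \<and> s 6 = u0"
  define Q where "Q = (\<lambda>t s'. ready s' \<and> (\<forall>a. a \<notin> scratch 1 \<longrightarrow> s' a = s a) \<and>
    (b0 \<le> s' 5 \<and> (s' 6 = u0 \<and> (f S < d - 1 \<or> d < u0) \<or>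
       s' 6 = Suc u0 \<and> u0 \<le> d \<and> d - 1 \<le> f S \<and> (\<forall>q<n. f (insert q S) \<le> s' 5))) \<and>
    t + T * extend_potential (s 5) (s 6) \<le> T * (10 + extend_potential (s' 5) (s' 6)))"
  have r: "s 1 = A + n" "s 2 = 1" "s 3 = A" "s 4 = 0" and S: "set_at n s A = S" using s by (auto simp: ready_def)
  have A: "A > 10" by (simp add: base_def)
  have sc: "a \<in> scratch 1" if "5 \<le> a" "a \<le> 10" for a using that by (simp add: scratch_def)
  \<comment> \<open>Shared by both rejecting branches: \<open>t + T + 7\<close> bounds the time of
    either, and \<open>Q_mono\<close> passes to the actual one.\<close>
  have skip: "wp f n T skip (\<lambda>t s'. Q (t + T + 7) s') (s(8 := x, 9 := y))" if "f S < d - 1 \<or> d < u0" for x y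
  proof -
    have "ready (s(8 := x, 9 := 0))" by (rule ready_cong[of s]) (use s A in auto)
    moreover have "1 + T + 7 \<le> T * 10" using T by simp
    ultimately show ?thesis
      unfolding skip_def Q_def using s r S sc[of 8] sc[of 9] that
      by (intro wp_Const) (auto simp: algebra_simps)
  qed
  have Q_mono: "Q t s' \<Longrightarrow> t' \<le> t \<Longrightarrow> Q t' s'" for t t' s' unfolding Q_def by auto
  have "wp f n T (extend_set d) Q s"
    unfolding extend_set_def
  proof (intro wp_Seq wp_Query wp_Const wp_Sub wp_If wp_Add, goal_cases)
    case 1
    let ?s = "s(8 := f S - (d - 2), 9 := d + 1 - u0, 6 := u0 + 1)"
    from 1 have u: "u0 \<le> d" and fS: "d - 1 \<le> f S" using r S s d by auto
    have rd: "ready ?s" by (rule ready_cong[of s]) (use s A in auto)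
    have S': "set_at n ?s A = S" unfolding S[symmetric]
      by (rule set_at_cong) (use A in simp)
    have "records (Suc 0) copy_potential (\<lambda>u. u = Suc u0) (for_elements 0 2 test_set)
      (\<lambda>S b. \<forall>i<n. f (update 2 i S) \<le> b) ((10 + 9) * n)"
      by (rule records_for_elements[OF _ _ records_test_set]) (use d in auto)
    then have "triple (Suc 0) copy_potential S (\<lambda>b u. b0 \<le> b \<and> u = Suc u0) (for_elements 0 2 test_set)
      (\<lambda>b u. b0 \<le> b \<and> u = Suc u0 \<and> (\<forall>i<n. f (update 2 i S) \<le> b)) ((10 + 9) * n)"
      unfolding records_def by blast
    then have W: "wp f n T (for_elements 0 2 test_set) (\<lambda>t s'. ready s' \<and> (\<forall>a. a \<notin> scratch (Suc 0) \<longrightarrow> s' a = ?s a) \<and>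
      (b0 \<le> s' 5 \<and> s' 6 = Suc u0 \<and> (\<forall>i<n. f (update 2 i S) \<le> s' 5)) \<and>
      t + T * copy_potential (?s 5) (?s 6) \<le> T * ((10 + 9) * n + copy_potential (s' 5) (s' 6))) ?s"
      by (rule tripleD[OF _ rd S']) (use s in simp)
    show ?case
    proof (rule wp_change[OF W], goal_cases)
      case 1
      then show ?case using r S s by auto
    next
      case (2 t s')
      then have fr: "s' a = s a" if "a \<notin> scratch 1" for a
        using that sc[of a] by auto
      have "t + T * copy_potential b0 u0 \<le> T * (19 * n + copy_potential (s' 5) (s' 6))"
        using 2 s A by (simp add: copy_potential_def)
      then have "T + 8 + t + T * extend_potential (s 5) (s 6) \<le> T * (10 + extend_potential (s' 5) (s' 6))"
        using 2 s T unfolding extend_potential_def by (simp add: algebra_simps)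
      then have "Q (T + 8 + t) s'"
        using 2 fr u fS unfolding Q_def by (simp add: update_def)
      then show ?case by (rule Q_mono) simp
    qed
  next
    case 2
    then have "d < u0" using s by (simp split: if_splits)
    show ?case
      by (rule wp_change[OF skip[of "f S - (d - 2)" "d + 1 - u0"]])
        (use \<open>d < u0\<close> r S s in \<open>auto intro: Q_mono\<close>)
  next
    case 3
    then have "f S < d - 1" using r S d by simp
    then show ?case
      by (intro wp_change[OF skip[of "f S - (d - 2)" "d - 2"]])
        (use r S s in \<open>auto intro: Q_mono\<close>)
  qed
  then show "wp f n T (extend_set d) (\<lambda>t s'. ready s' \<and> (\<forall>a. a \<notin> scratch 1 \<longrightarrow> s' a = s a) \<and>
    (b0 \<le> s' 5 \<and> (s' 6 = u0 \<and> (f S < d - 1 \<or> d < u0) \<or>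
       s' 6 = Suc u0 \<and> u0 \<le> d \<and> d - 1 \<le> f S \<and> (\<forall>q<n. f (insert q S) \<le> s' 5))) \<and>
    t + T * extend_potential (s 5) (s 6) \<le> T * (10 + extend_potential (s' 5) (s' 6))) s"
    unfolding Q_def .
qed

text \<open>\<open>C\<close> is the set of tried elements. The machine keeps only their number, so
  \<open>C\<close> is existentially quantified.\<close>

definition extensions_recorded :: "nat set \<Rightarrow> nat \<Rightarrow> bool" where
  "extensions_recorded S b \<longleftrightarrow> (\<exists>C\<subseteq>{..<n}. (\<forall>c\<in>C. d - 1 \<le> f (insert c S) \<and> (\<forall>q<n. f (insert q (insert c S)) \<le> b)) \<and>
     (card C = d + 1 \<or> (\<forall>c<n. d - 1 \<le> f (insert c S) \<longrightarrow> c \<in> C)))"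

text \<open>The cost consists of \<open>19 * n\<close> for the loop over \<open>c\<close>,
  \<open>19 * n\<close> for each of at most \<open>d + 1\<close> counter increments, and
  \<open>n\<close> to absorb the reset of the counter.\<close>

lemma records_extend_set:
  "records 2 copy_potential (\<lambda>u. True) (Seq (Const 6 0) (for_elements 1 2 (extend_set d)))
     extensions_recorded ((20 + 19 * (d + 1)) * n)"
  unfolding records_def
proof (intro allI)
  fix S b0
  \<comment> \<open>As the loop counts down, \<open>{j..<n}\<close> are the elements already
    passed.\<close>
  define E where "E j b u C \<longleftrightarrow> C \<subseteq> {j..<n} \<and> card C = u \<and>
     (\<forall>c\<in>C. d - 1 \<le> f (insert c S) \<and> (\<forall>q<n. f (insert q (insert c S)) \<le> b)) \<and>
     (u = d + 1 \<or> (\<forall>c\<in>{j..<n}. d - 1 \<le> f (insert c S) \<longrightarrow> c \<in> C))" for j b u C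
  define I where "I j b u \<longleftrightarrow> b0 \<le> b \<and> u \<le> d + 1 \<and> (\<exists>C. E j b u C)" for j b u
  have step: "triple 1 extend_potential (update 2 j S) (I (Suc j)) (extend_set d) (I j) 10" if j: "j < n" for j
    unfolding triple_def
  proof (intro allI impI)
    fix s assume s: "ready s \<and> set_at n s A = update 2 j S \<and> I (Suc j) (s 5) (s 6)"
    then obtain C where C: "E (Suc j) (s 5) (s 6) C" and u: "s 6 \<le> d + 1" and b: "b0 \<le> s 5"
      by (auto simp: I_def)
    have finC: "finite C" "j \<notin> C" using C finite_subset[of C "{Suc j..<n}"] by (auto simp: E_def)
    have ins: "{j..<n} = insert j {Suc j..<n}" using j by auto
    have "wp f n T (extend_set d) (\<lambda>t s'. ready s' \<and> (\<forall>a. a \<notin> scratch 1 \<longrightarrow> s' a = s a) \<and>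
      (s 5 \<le> s' 5 \<and> (s' 6 = s 6 \<and> (f (update 2 j S) < d - 1 \<or> d < s 6) \<or>
       s' 6 = Suc (s 6) \<and> s 6 \<le> d \<and> d - 1 \<le> f (update 2 j S) \<and> (\<forall>q<n. f (insert q (update 2 j S)) \<le> s' 5))) \<and>
      t + T * extend_potential (s 5) (s 6) \<le> T * (10 + extend_potential (s' 5) (s' 6))) s"
      using triple_extend_set[of "update 2 j S" "s 5" "s 6"] s unfolding triple_def by blast
    then show "wp f n T (extend_set d) (\<lambda>t s'. ready s' \<and> (\<forall>a. a \<notin> scratch 1 \<longrightarrow> s' a = s a) \<and> I j (s' 5) (s' 6) \<and>
      t + T * extend_potential (s 5) (s 6) \<le> T * (10 + extend_potential (s' 5) (s' 6))) s"
    proof (rule wp_mono, elim conjE, intro conjI, goal_cases)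
      case (3 t s')
      have le: "s 5 \<le> s' 5" by fact
      have alt: "s' 6 = s 6 \<and> (f (update 2 j S) < d - 1 \<or> d < s 6) \<or>
         s' 6 = Suc (s 6) \<and> s 6 \<le> d \<and> d - 1 \<le> f (update 2 j S) \<and> (\<forall>q<n. f (insert q (update 2 j S)) \<le> s' 5)"
        by fact
      have C1: "C \<subseteq> {Suc j..<n}" "card C = s 6"
        "s 6 = d + 1 \<or> (\<forall>c\<in>{Suc j..<n}. d - 1 \<le> f (insert c S) \<longrightarrow> c \<in> C)"
        using C unfolding E_def by blast+
      have C2: "d - 1 \<le> f (insert c S) \<and> (\<forall>q<n. f (insert q (insert c S)) \<le> s' 5)" if "c \<in> C" for c
      proof -
        have "d - 1 \<le> f (insert c S) \<and> (\<forall>q<n. f (insert q (insert c S)) \<le> s 5)"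
          using C that unfolding E_def by blast
        then show ?thesis using order_trans[OF _ le] by simp
      qed
      have "\<exists>C. E j (s' 5) (s' 6) C"
      proof (cases "s' 6 = s 6")
        case True
        then have "s 6 = d + 1 \<or> f (insert j S) < d - 1" using alt u by (auto simp: update_def)
        then have "E j (s' 5) (s' 6) C"
          unfolding E_def ins True using C1 C2 by auto
        then show ?thesis ..
      next
        case False
        then have *: "s' 6 = Suc (s 6)" "d - 1 \<le> f (insert j S)" "s 6 \<le> d"
          "\<forall>q<n. f (insert q (insert j S)) \<le> s' 5"
          using alt by (auto simp: update_def)
        have "card (insert j C) = s' 6" using C1 finC * by simp
        moreover have "s' 6 = d + 1 \<or> (\<forall>c\<in>{Suc j..<n}. d - 1 \<le> f (insert c S) \<longrightarrow> c \<in> C)"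
          using C1(3) * by auto
        ultimately have "E j (s' 5) (s' 6) (insert j C)"
          unfolding E_def ins using C1(1) C2 *(2,4) by blast
        then show ?thesis ..
      qed
      then show ?case using alt le u b unfolding I_def by auto
    qed auto
  qed
  have step: "triple (Suc 1) extend_potential S (I n) (for_elements 1 2 (extend_set d)) (I 0) ((10 + 9) * n)"
    by (rule triple_for_elements[OF _ _ step]) (use d in auto)
  \<comment> \<open>The counter part of the potential, which starts at 0, is turned into proper
    cost.\<close>
  have loop: "triple 2 copy_potential S (\<lambda>b u. b0 \<le> b \<and> u = 0) (for_elements 1 2 (extend_set d))
    (\<lambda>b u. b0 \<le> b \<and> extensions_recorded S b) ((19 + 19 * (d + 1)) * n)"
  proof (rule triple_conseq[OF step[unfolded Suc_1]], goal_cases)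
    case (1 b u)
    then show ?case by (auto simp: I_def E_def)
  next
    case (2 b u)
    then obtain C where "E 0 b u C" "b0 \<le> b" by (auto simp: I_def)
    then show ?case unfolding extensions_recorded_def E_def
      by (intro conjI exI[of _ C]) auto
  next
    case (3 b u b' u')
    then have "19 * n * u' \<le> 19 * n * (d + 1)" by (intro mult_left_mono) (auto simp: I_def)
    with 3 show ?case by (simp add: extend_potential_def copy_potential_def algebra_simps)
  qed
  show "triple 2 copy_potential S (\<lambda>b u. b0 \<le> b \<and> True) (Seq (Const 6 0) (for_elements 1 2 (extend_set d)))
     (\<lambda>b u. b0 \<le> b \<and> True \<and> extensions_recorded S b) ((20 + 19 * (d + 1)) * n)"
    unfolding triple_def
  proof (intro allI impI)
    fix s assume s: "ready s \<and> set_at n s A = S \<and> b0 \<le> s 5 \<and> True"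
    have A: "A > 10" by (simp add: base_def)
    have r0: "ready (s(6 := 0))" by (rule ready_cong[of s]) (use s A in auto)
    have S0: "set_at n (s(6 := 0)) A = S"
      using s set_at_cong[of "s(6 := 0)" A s] A by simp
    have W: "wp f n T (for_elements 1 2 (extend_set d)) (\<lambda>t s'. ready s' \<and> (\<forall>a. a \<notin> scratch 2 \<longrightarrow> s' a = (s(6 := 0)) a) \<and>
      (b0 \<le> s' 5 \<and> extensions_recorded S (s' 5)) \<and>
      t + T * copy_potential ((s(6 := 0)) 5) ((s(6 := 0)) 6) \<le> T * ((19 + 19 * (d + 1)) * n + copy_potential (s' 5) (s' 6))) (s(6 := 0))"
      by (rule tripleD[OF loop r0 S0]) (use s in simp)
    have le: "1 + T * ((19 + 19 * (d + 1)) * n + x) \<le> T * ((20 + 19 * (d + 1)) * n + x)" for x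
    proof -
      have "1 \<le> T * n" using T n by simp
      moreover have "T * ((20 + 19 * (d + 1)) * n + x) = T * n + T * ((19 + 19 * (d + 1)) * n + x)"
        by (simp add: algebra_simps)
      ultimately show ?thesis by linarith
    qed
    have six: "6 \<in> scratch 2" by (simp add: scratch_def)
    show "wp f n T (Seq (Const 6 0) (for_elements 1 2 (extend_set d))) (\<lambda>t s'. ready s' \<and> (\<forall>a. a \<notin> scratch 2 \<longrightarrow> s' a = s a) \<and>
      (b0 \<le> s' 5 \<and> True \<and> extensions_recorded S (s' 5)) \<and>
      t + T * copy_potential (s 5) (s 6) \<le> T * ((20 + 19 * (d + 1)) * n + copy_potential (s' 5) (s' 6))) s"
    proof (intro wp_Seq wp_Const, rule wp_change[OF W], goal_cases)
      case (2 t s')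
      then have "1 + t + T * copy_potential (s 5) (s 6) \<le>
          1 + T * ((19 + 19 * (d + 1)) * n + copy_potential (s' 5) (s' 6))"
        by (simp add: copy_potential_def)
      also have "\<dots> \<le> T * ((20 + 19 * (d + 1)) * n + copy_potential (s' 5) (s' 6))"
        by (rule le)
      finally show ?case using 2 six by auto
    qed simp
  qed
qed

section \<open>Initialising the stored sets\<close>

lemma wp_fill_sets:
  assumes "s 0 = n" "s 1 = A + n" "s 2 = 1" "s 3 = A" "s 4 = 0"
  shows "wp f n T fill_sets (\<lambda>t s'. (\<forall>a\<le>6. s' a = s a) \<and>
    set_at n s' A = {..<n} \<and> set_at n s' (A + n) = {..<n} \<and> t \<le> T * (6 * n + 2)) s"
proof -
  define J where "J j s' \<longleftrightarrow> (\<forall>a\<le>6. s' a = s a) \<and>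
    (\<forall>i. j \<le> i \<and> i < n \<longrightarrow> s' (A + i) = 1 \<and> s' (A + n + i) = 1)" for j s'
  have A: "A > 10" by (simp add: base_def)
  have W: "wp f n T (While 9 (Seq (Sub 9 9 2) (Seq (Add 7 3 9) (Seq (Store 7 2)
     (Seq (Add 7 1 9) (Store 7 2))))))
     (\<lambda>t s'. J 0 s' \<and> t + T * 0 \<le> T * ((5 + 1) * n + 1 + 0)) (s(9 := n))"
  proof (rule wp_While[OF _ T])
    fix j s2 assume j: "j < n" and J: "J (Suc j) s2" and i: "s2 9 = Suc j"
    then have r: "s2 1 = A + n" "s2 2 = 1" "s2 3 = A" using assms A by (simp_all add: J_def)
    have "J j (s2(9 := j, 7 := A + j, A + j := 1, 7 := A + n + j, A + n + j := 1))"
      using J A j by (auto simp: J_def Suc_le_eq)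
    moreover have "5 \<le> T * 5" using T by simp
    ultimately show "wp f n T (Seq (Sub 9 9 2) (Seq (Add 7 3 9) (Seq (Store 7 2)
       (Seq (Add 7 1 9) (Store 7 2)))))
       (\<lambda>t s'. J j s' \<and> s' 9 = j \<and> t + T * 0 \<le> T * (5 + 0)) s2"
      using r i A by (intro wp_intros) simp
  qed (use A in \<open>auto simp: J_def\<close>)
  show ?thesis
    unfolding fill_sets_def
  proof (intro wp_Seq wp_Add, rule wp_change[OF W], goal_cases)
    case 1
    then show ?case using assms by simp
  next
    case (2 t s')
    then have "set_at n s' (A + n) = {..<n}" "set_at n s' A = {..<n}"
      by (auto simp: J_def set_at_def)
    then show ?case using 2 T by (simp add: J_def)
  qed
qed

lemma wp_clear_set:
  assumes "ready s"
  shows "wp f n T clear_set (\<lambda>t s'. ready s' \<and> s' 5 = s 5 \<and> s' 6 = s 6 \<and>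
    set_at n s' A = {} \<and> t \<le> T * (6 * n + 2)) s"
proof -
  define J where "J j s' \<longleftrightarrow> ready s' \<and> s' 5 = s 5 \<and> s' 6 = s 6 \<and>
    (\<forall>i. j \<le> i \<and> i < n \<longrightarrow> s' (A + i) = 0)" for j s'
  have A: "A > 10" by (simp add: base_def)
  have W: "wp f n T (While 9 (Seq (Sub 9 9 2) (Seq (Add 7 3 9) (Store 7 4))))
     (\<lambda>t s'. J 0 s' \<and> t + T * 0 \<le> T * ((5 + 1) * n + 1 + 0)) (s(9 := n))"
  proof (rule wp_While[OF _ T])
    fix j s2 assume j: "j < n" and J: "J (Suc j) s2" and i: "s2 9 = Suc j"
    then have r: "s2 2 = 1" "s2 3 = A" "s2 4 = 0" "ready s2" by (simp_all add: J_def ready_def)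
    have "ready (s2(9 := j, 7 := A + j, A + j := 0))"
      by (rule ready_cong[OF r(4)]) (use A j in auto)
    then have "J j (s2(9 := j, 7 := A + j, A + j := 0))"
      using J A j by (auto simp: J_def Suc_le_eq)
    moreover have "3 \<le> T * 5" using T by simp
    ultimately show "wp f n T (Seq (Sub 9 9 2) (Seq (Add 7 3 9) (Store 7 4)))
       (\<lambda>t s'. J j s' \<and> s' 9 = j \<and> t + T * 0 \<le> T * (5 + 0)) s2"
      using r i A by (intro wp_intros) simp
  next
    have "ready (s(9 := n))" by (rule ready_cong[OF assms]) (use A in auto)
    then show "J n (s(9 := n))" by (simp add: J_def)
  qed (use A in \<open>auto simp: J_def\<close>)
  show ?thesis
    unfolding clear_set_def
  proof (intro wp_Seq wp_Add, rule wp_change[OF W], goal_cases)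
    case 1
    then show ?case using assms by (simp add: ready_def)
  next
    case (2 t s')
    then have "set_at n s' A = {}"
      by (auto simp: J_def set_at_def)
    then show ?case using 2 T by (simp add: J_def)
  qed
qed

section \<open>Sets reached by the nested loops\<close>

text \<open>The elements of \<open>W\<close> may be chosen in any order; any one of them serves as
  the choice of the outermost loop.\<close>

lemma for_all_updates_insert:
  assumes "for_all_updates 2 j R S b" "W \<subseteq> {..<n}" "card W = j"
  shows "R (W \<union> S) b"
  using assms
proof (induction j arbitrary: S W)
  case 0
  then have "W = {}" using finite_subset by fastforce
  with 0 show ?case by simp
next
  case (Suc j)
  then obtain i where i: "i \<in> W" by fastforce
  have "R (W - {i} \<union> insert i S) b"
    using Suc.prems i by (intro Suc.IH) (auto simp: update_def)
  moreover have "W - {i} \<union> insert i S = W \<union> S" using i by auto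
  ultimately show ?case by simp
qed

text \<open>Repetitions among the removed elements account for the smaller sets \<open>W\<close>.\<close>

lemma for_all_updates_remove:
  assumes "for_all_updates 4 j R S b" "W \<subseteq> {..<n}" "card W \<le> j" "W \<noteq> {} \<or> j = 0"
  shows "R (S - W) b"
  using assms
proof (induction j arbitrary: S W)
  case 0
  then have "W = {}" using finite_subset by fastforce
  with 0 show ?case by simp
next
  case (Suc j)
  then obtain i where i: "i \<in> W" by fastforce
  have step: "for_all_updates 4 j R (S - {i}) b"
    using Suc.prems(1,2) i by (auto simp: update_def)
  have "card (W - {i}) \<le> j" using Suc.prems(3) i by (simp add: card_Diff_singleton)
  show ?case
  proof (cases "W - {i} = {} \<and> j \<noteq> 0")
    case True
    then have "R (S - {i} - {i}) b"
      using step Suc.prems(2) i by (intro Suc.IH) auto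
    moreover have "S - {i} - {i} = S - W" using True i by auto
    ultimately show ?thesis by simp
  next
    case False
    then have "R (S - {i} - (W - {i})) b"
      using step Suc.prems(2) \<open>card (W - {i}) \<le> j\<close> by (intro Suc.IH) auto
    moreover have "S - {i} - (W - {i}) = S - W" using i by auto
    ultimately show ?thesis by simp
  qed
qed

section \<open>Correctness and total running time\<close>

text \<open>Summands in order: the first pass, the second pass, the growth of
  \<open>copy_potential\<close> up to the value \<open>d\<close>, and everything else, where
  \<open>12 * n + 9 \<le> 21 * n\<close>.\<close>

definition time_factor :: nat where
  "time_factor = 10 ^ (d - 1) * 10 + 10 ^ (d - 2) * (20 + 19 * (d + 1)) + 10 * d + 21"

lemma wp_maximization_program:
  assumes f_le: "\<And>X. X \<subseteq> {..<n} \<Longrightarrow> f X \<le> d"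
  shows "wp f n T (maximization_program d) (\<lambda>t s. set_at n s (s 1) \<noteq> {} \<and> s 0 = f (set_at n s (s 1)) \<and>
     f {..<n} \<le> s 0 \<and> for_all_updates 4 (d - 1) (\<lambda>S b. f S \<le> b) {..<n} (s 0) \<and>
     for_all_updates 2 (d - 2) extensions_recorded {} (s 0) \<and> t \<le> T * (time_factor * n ^ (d - 1))) (init_memory n)"
    (is "wp _ _ _ _ ?Q _")
proof -
  define B where "B = 10 * n"
  define K1 K2 where "K1 = 10 ^ (d - 1) * 10 * n ^ (d - 1)"
    and "K2 = 10 ^ (d - 2) * (20 + 19 * (d + 1)) * n ^ (d - 1)"
  have A: "A > 10" by (simp add: base_def)
  let ?s = "(init_memory n)(2 := 1, 3 := A, 1 := A + n)"
  have fill: "wp f n T fill_sets (\<lambda>t s'. (\<forall>a\<le>6. s' a = ?s a) \<and>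
    set_at n s' A = {..<n} \<and> set_at n s' (A + n) = {..<n} \<and> t \<le> T * (6 * n + 2)) ?s"
    by (rule wp_fill_sets) (simp_all add: init_memory_def)
  have "records (0 + (d - 1)) copy_potential (\<lambda>u. True) (nested_for 0 4 (d - 1) test_set)
      (for_all_updates 4 (d - 1) (\<lambda>S b. f S \<le> b)) (10 ^ (d - 1) * 10 * n ^ (0 + (d - 1)))"
    by (rule records_nested_for) (use records_test_set in auto)
  then have r1: "records (d - 1) copy_potential (\<lambda>u. True) (nested_for 0 4 (d - 1) test_set)
      (for_all_updates 4 (d - 1) (\<lambda>S b. f S \<le> b)) K1"
    by (simp add: K1_def)
  have "records (2 + (d - 2)) copy_potential (\<lambda>u. True)
      (nested_for 2 2 (d - 2) (Seq (Const 6 0) (for_elements 1 2 (extend_set d))))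
      (for_all_updates 2 (d - 2) extensions_recorded) (10 ^ (d - 2) * (20 + 19 * (d + 1)) * n ^ (1 + (d - 2)))"
  proof (rule records_nested_for)
    show "extensions_recorded S b'" if "extensions_recorded S b" "b \<le> b'" for S b b'
      using that unfolding extensions_recorded_def by (meson order_trans)
  qed (use d records_extend_set in auto)
  then have r2: "records d copy_potential (\<lambda>u. True)
      (nested_for 2 2 (d - 2) (Seq (Const 6 0) (for_elements 1 2 (extend_set d))))
      (for_all_updates 2 (d - 2) extensions_recorded) K2"
    using d by (simp add: K2_def Suc_diff_le[symmetric] numeral_2_eq_2)
  show ?thesis
    unfolding maximization_program_def
  proof (intro wp_Seq wp_Const wp_Add, rule wp_change[OF fill], goal_cases)
    case 1
    then show ?case by (simp add: init_memory_def)
  next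
    case (2 t1 s1)
    define s2 where "s2 = s1(5 := f {..<n})"
    have s1: "s1 0 = n" "s1 1 = A + n" "s1 2 = 1" "s1 3 = A" "s1 4 = 0"
      and full: "set_at n s1 A = {..<n}" "set_at n s1 (A + n) = {..<n}" and t1: "t1 \<le> T * (6 * n + 2)"
      using 2 by (simp_all add: init_memory_def)
    have full2: "set_at n s2 A = {..<n}" "set_at n s2 (A + n) = {..<n}"
      using full set_at_cong[of s2 A s1] set_at_cong[of s2 "A + n" s1] A by (simp_all add: s2_def)
    have ready2: "ready s2"
    proof -
      have "0 \<in> {..<n}" using n by simp
      then have "{..<n} \<noteq> {}" by blast
      then show ?thesis unfolding ready_def full2 using s1 by (simp add: s2_def)
    qed
    have "wp f n T (nested_for 0 4 (d - 1) test_set) (\<lambda>t s'. ready s' \<and> (\<forall>a. a \<notin> scratch (d - 1) \<longrightarrow> s' a = s2 a) \<and>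
      (f {..<n} \<le> s' 5 \<and> True \<and> for_all_updates 4 (d - 1) (\<lambda>S b. f S \<le> b) {..<n} (s' 5)) \<and>
      t + T * copy_potential (s2 5) (s2 6) \<le> T * (K1 + copy_potential (s' 5) (s' 6))) s2"
      by (rule tripleD[OF r1[unfolded records_def, rule_format] ready2 full2(1)]) (simp add: s2_def)
    then have "wp f n T (nested_for 0 4 (d - 1) test_set)
      (\<lambda>t2. wp f n T (Seq clear_set (Seq (nested_for 2 2 (d - 2) (Seq (Const 6 0) (for_elements 1 2 (extend_set d)))) (Add 0 5 4)))
        (\<lambda>u. ?Q (1 + (1 + (1 + (t1 + (T + (t2 + u)))))))) s2"
    proof (rule wp_mono, intro wp_Seq, goal_cases)
      case (1 t2 s3)
      then have s3: "ready s3" "f {..<n} \<le> s3 5" "for_all_updates 4 (d - 1) (\<lambda>S b. f S \<le> b) {..<n} (s3 5)"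
        and t2: "t2 + T * (B * s2 5) \<le> T * (K1 + B * s3 5)"
        by (auto simp: copy_potential_def B_def)
      from wp_clear_set[OF s3(1)] show ?case
      proof (rule wp_mono, goal_cases)
        case (1 t3 s4)
        then have s4: "ready s4" "s4 5 = s3 5" "set_at n s4 A = {}" and t3: "t3 \<le> T * (6 * n + 2)"
          by auto
        have loops: "wp f n T (nested_for 2 2 (d - 2) (Seq (Const 6 0) (for_elements 1 2 (extend_set d)))) (\<lambda>t s'. ready s' \<and> (\<forall>a. a \<notin> scratch d \<longrightarrow> s' a = s4 a) \<and>
          (s4 5 \<le> s' 5 \<and> True \<and> for_all_updates 2 (d - 2) extensions_recorded {} (s' 5)) \<and>
          t + T * copy_potential (s4 5) (s4 6) \<le> T * (K2 + copy_potential (s' 5) (s' 6))) s4"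
          by (rule tripleD[OF r2[unfolded records_def, rule_format] s4(1,3)]) simp
        show ?case
        proof (rule wp_Seq, rule wp_mono[OF loops], intro wp_Add, goal_cases)
          case (1 t4 s5)
          then have s5: "ready s5" "s3 5 \<le> s5 5" "for_all_updates 2 (d - 2) extensions_recorded {} (s5 5)"
            and t4: "t4 + T * (B * s3 5) \<le> T * (K2 + B * s5 5)"
            using s4 by (auto simp: copy_potential_def B_def)
          let ?s6 = "s5(0 := s5 5 + s5 4)"
          have s6: "?s6 0 = s5 5" "?s6 1 = A + n" and out: "set_at n ?s6 (A + n) = set_at n s5 (A + n)"
            using s5(1) A set_at_cong[of ?s6 "A + n" s5] by (auto simp: ready_def)
          have best: "set_at n s5 (A + n) \<noteq> {}" "s5 5 = f (set_at n s5 (A + n))"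
            using s5(1) by (auto simp: ready_def)
          then have "s5 5 \<le> d" using f_le[of "set_at n s5 (A + n)"] by (auto simp: set_at_def)
          then have "B * s5 5 \<le> B * d" by (intro mult_left_mono) auto
          then have "T * (K2 + B * s5 5) \<le> T * (K2 + B * d)" by (intro mult_left_mono) auto
          with t4 have t4: "t4 + T * (B * s3 5) \<le> T * (K2 + B * d)" by (rule order_trans)
          \<comment> \<open>The potential at \<open>s3\<close> cancels between the two
            passes.\<close>
          have "t2 + t4 \<le> T * (K1 + K2 + B * d)"
            using t2 t4 by (simp add: algebra_simps)
          with t1 t3 T have "1 + (1 + (1 + (t1 + (T + (t2 + (t3 + (t4 + 1))))))) \<le>
            T * (6 * n + 2) + T * (6 * n + 2) + T * (K1 + K2 + B * d) + 5 * T" by linarith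
          also have "\<dots> = T * (12 * n + 9 + K1 + K2 + B * d)" by (simp add: algebra_simps)
          also have "\<dots> \<le> T * (time_factor * n ^ (d - 1))"
          proof (rule mult_left_mono)
            \<comment> \<open>\<open>d \<ge> 2\<close> lets the linear terms fit under
              \<open>n ^ (d - 1)\<close>.\<close>
            have "n ^ 1 \<le> n ^ (d - 1)" using d n by (intro power_increasing) auto
            then have "n * (21 + 10 * d) \<le> n ^ (d - 1) * (21 + 10 * d)" by (intro mult_right_mono) auto
            then show "12 * n + 9 + K1 + K2 + B * d \<le> time_factor * n ^ (d - 1)"
              using n unfolding K1_def K2_def B_def time_factor_def by (simp add: algebra_simps)
          qed simp
          finally show ?case
            unfolding s6(2) out s6(1) using best s5 s3 for_all_updates_mono[OF s3(3) s5(2)]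
            by (simp add: order_trans)
        qed
      qed
    qed
    moreover have "s1(5 := f (set_at n s1 (s1 1))) = s2"
      using s1 full by (simp add: s2_def)
    ultimately show ?case
      by (intro wp_Seq wp_Query) (erule wp_change)
  qed
qed

lemma wp_maximization_program_correct:
  assumes f: "f \<in> instances d n"
  shows "wp f n T (maximization_program d) (\<lambda>t s. is_maximizer n f (set_at n s (s 1)) \<and>
     s 0 = f (set_at n s (s 1)) \<and> t \<le> T * (time_factor * n ^ (d - 1))) (init_memory n)"
proof -
  interpret posimodular_fun "{..<n}" f d
  proof
    fix X Y assume "X \<subseteq> {..<n}" "Y \<subseteq> {..<n}"
    with f have "real (f (X - Y)) + real (f (Y - X)) \<le> real (f X) + real (f Y)"
      unfolding instances_def posimodular_def by blast
    then show "f (X - Y) + f (Y - X) \<le> f X + f Y" by linarith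
  qed (use f in \<open>auto simp: instances_def\<close>)
  show ?thesis
  proof (rule wp_mono[OF wp_maximization_program], goal_cases)
    case (2 t s)
    let ?X = "set_at n s (s 1)"
    have "f Y \<le> s 0" if Y: "Y \<subseteq> {..<n}" for Y
      using d
    proof (cases rule: maximizer_search_space)
      case (cosmall W)
      have "f ({..<n} - W) \<le> s 0"
      \<comment> \<open>For empty \<open>W\<close> the initial query of the ground set is used,
        since the loops remove at least one element.\<close>
      proof (cases "W = {}")
        case False
        then show ?thesis using for_all_updates_remove[of "d - 1" "\<lambda>S b. f S \<le> b"] 2 cosmall by blast
      qed (use 2 in simp)
      then show ?thesis using maximizers_le[OF cosmall(3) Y] by simp
    next
      case (greedy B K p)
      have "extensions_recorded (B \<union> {}) (s 0)"
        using for_all_updates_insert[of "d - 2" extensions_recorded "{}" "s 0" B] 2 greedy(1,2) by blast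
      then obtain C where C: "C \<subseteq> {..<n}"
        "\<And>c. c \<in> C \<Longrightarrow> d - 1 \<le> f (insert c B) \<and> (\<forall>q<n. f (insert q (insert c B)) \<le> s 0)"
        "card C = d + 1 \<or> (\<forall>c<n. d - 1 \<le> f (insert c B) \<longrightarrow> c \<in> C)"
        unfolding extensions_recorded_def by auto
      \<comment> \<open>Either \<open>d + 1\<close> elements were tried, more than \<open>K\<close>
        contains, or all candidates were tried, among them \<open>p\<close>, which lies outside
        \<open>K\<close>.\<close>
      have "\<exists>c. c \<in> C - K"
      proof (cases "card C = d + 1")
        case True
        have "\<not> C \<subseteq> K" using card_mono[OF greedy(3), of C] greedy(4) True by auto
        then show ?thesis by blast
      next
        case False
        then show ?thesis using C(3) greedy(5,6) by auto
      qed
      then obtain c where c: "c \<in> C" "c \<notin> K" by blast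
      then obtain q where "q < n" "f (insert q (insert c B)) = d"
        using greedy(7)[of c] C(1) C(2)[of c] by auto
      then have "d \<le> s 0" using C(2)[OF c(1)] by auto
      then show ?thesis using f_le[OF Y] by simp
    qed
    moreover have "?X \<subseteq> {..<n}" by (auto simp: set_at_def)
    ultimately show ?case using 2 unfolding is_maximizer_def by auto
  qed (rule f_le)
qed

end

section \<open>Asymptotic form of the upper bound\<close>

lemma maximization_upper_bound:
  assumes d: "d \<ge> 2"
  shows "\<exists>P. solves_maximization d P \<and> (\<lambda>(n, T). real (worst_case_time d P n T))
    \<in> O[size_cost_filter](\<lambda>(n, T). real n ^ (d - 1) * real T)"
proof (intro exI conjI)
  let ?P = "maximization_program d"
  \<comment> \<open>This locale constant depends on \<open>d\<close> alone, so it serves all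
    \<open>n\<close>, \<open>T\<close> and \<open>f\<close>.\<close>
  define c where "c = maximization_machine.time_factor d"
  have run: "\<exists>t s. run f n T ?P (init_memory n) t s \<and> is_maximizer n f (set_at n s (s 1)) \<and>
      s 0 = f (set_at n s (s 1)) \<and> t \<le> T * (c * n ^ (d - 1))"
    if "n \<ge> 1" "T \<ge> 1" "f \<in> instances d n" for n T f
  proof -
    interpret maximization_machine f n T d
      using that d by unfold_locales (auto simp: instances_def)
    show ?thesis
      using wp_maximization_program_correct[OF that(3)] unfolding wp_def c_def by blast
  qed
  then show "solves_maximization d ?P"
    unfolding solves_maximization_def by blast
  have bound: "worst_case_time d ?P n T \<le> T * (c * n ^ (d - 1))" if "n \<ge> 1" "T \<ge> 1" for n T
    by (rule worst_case_time_le) (use run that in blast)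
  show "(\<lambda>(n, T). real (worst_case_time d ?P n T))
    \<in> O[size_cost_filter](\<lambda>(n, T). real n ^ (d - 1) * real T)"
  proof (rule landau_o.bigI[of "real c + 1"])
    show "\<forall>\<^sub>F x in size_cost_filter. norm (case x of (n, T) \<Rightarrow> real (worst_case_time d ?P n T))
      \<le> (real c + 1) * norm (case x of (n, T) \<Rightarrow> real n ^ (d - 1) * real T)"
    proof (rule eventually_size_cost_filter[of 1])
      fix n T :: nat assume "1 \<le> n" "1 \<le> T"
      then have "real (worst_case_time d ?P n T) \<le> real (T * (c * n ^ (d - 1)))"
        using bound of_nat_le_iff by blast
      also have "\<dots> \<le> (real c + 1) * (real n ^ (d - 1) * real T)"
        by (simp add: algebra_simps)
      finally show "norm (case (n, T) of (n, T) \<Rightarrow> real (worst_case_time d ?P n T))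
        \<le> (real c + 1) * norm (case (n, T) of (n, T) \<Rightarrow> real n ^ (d - 1) * real T)"
        by simp
    qed
  qed simp
qed

theorem theorem6:
  fixes d :: nat
  assumes "d \<ge> 2"
  shows "maximization_has_time_complexity d (\<lambda>n T. real n ^ (d - 1) * real T)"
  unfolding maximization_has_time_complexity_def
  using maximization_upper_bound[OF assms] maximization_lower_bound[OF _ assms] by blast

end
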